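(* Let $\lambda\in(0,1)$ and let $f\in\mathcal{U}_\lambda$ with expansion $f(z)=z+\sum_{n=2}^\infty a_nz^n$, $z\in\mathbb{D}$. (1) If $U_f\not\equiv 0$, then $f$ has a $\lambda$-quasiconformal extension onto $\widehat{\mathbb{C}}$, given explicitly by $$F(z)=\begin{cases}\dfrac{z}{1-a_2z+\phi(z)}, & |z|<1,\\[2mm] \dfrac{z}{1-a_2z+|z|^2\phi(1/\overline{z})}, & |z|\ge 1,\end{cases}$$ where $\phi(z)=z/f(z)+a_2z-1$ for $z\in\mathbb{D}$ (so that $f(z)=z/(1-a_2z+\phi(z))$ on $\mathbb{D}$ and $\phi(0)=\phi'(0)=0$). (2) If $U_f\equiv 0$ and $a_2\in\mathbb{D}\setminus\{0\}$, then $f$ has an $|a_2|$-quasiconformal extension onto $\widehat{\mathbb{C}}$ of the form $$F(z)=\begin{cases}\dfrac{z}{1-a_2z}, & |z|<1,\\[2mm] \dfrac{z(|z|^2-a_2z)}{(|z|-a_2z)^2}, & |z|\ge 1.\end{cases}$$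
   Context: $\mathbb{D}=\{z\in\mathbb{C}:|z|<1\}$, $\widehat{\mathbb{C}}=\mathbb{C}\cup\{\infty\}$. $\mathcal{A}$ is the class of analytic functions $f$ on $\mathbb{D}$ with $f(0)=0=f'(0)-1$. For $f\in\mathcal{A}$ put $U_f(z)=(z/f(z))^2f'(z)-1$, $z\in\mathbb{D}$ (with the removable singularity at $0$ filled in; $z/f(z)$ has value $1$ at $0$). For $\lambda\in(0,1]$, $\mathcal{U}_\lambda$ is the class of $f\in\mathcal{A}$ with $|U_f(z)|<\lambda$ for all $z\in\mathbb{D}$ (in particular $U_f$ has no poles in $\mathbb{D}$, so $f$ has no zeros in $\mathbb{D}\setminus\{0\}$ and $z/f(z)$ is analytic in $\mathbb{D}$). For $k\in[0,1)$, a $k$-quasiconformal mapping of $\widehat{\mathbb{C}}$ is a sense-preserving homeomorphism $F:\widehat{\mathbb{C}}\to\widehat{\mathbb{C}}$ belonging to the Sobolev space $W^{1,2}_{\mathrm{loc}}(\widehat{\mathbb{C}})$ with $|F_{\bar z}|\le k|F_z|$ a.e. A $k$-quasiconformal extension onto $\widehat{\mathbb{C}}$ of a conformal map $f$ on a domain $\Omega$ is such an $F$ with $F|_\Omega=f$. Formulas for $F$ are read as maps into $\widehat{\mathbb{C}}$ (the value is $\infty$ where the denominator vanishes); values at $z=\infty$, and values of $\phi$ on $|z|=1$, are understood by continuous extension. *)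

theory Defs
  imports "HOL-Complex_Analysis.Complex_Analysis"
begin

section \<open>The Riemann sphere\<close>

text \<open>The sphere is \<^typ>\<open>complex option\<close>, where \<^term>\<open>None\<close> is the point at infinity. It carries
  the topology of the one-point compactification of the plane.\<close>

type_synonym riemann_sphere = "complex option"

definition sphere_open :: "riemann_sphere set \<Rightarrow> bool" where
  "sphere_open U \<longleftrightarrow>
     open {z. Some z \<in> U} \<and> (None \<in> U \<longrightarrow> compact {z. Some z \<notin> U})"

definition sphere_topology :: "riemann_sphere topology" where
  "sphere_topology = topology sphere_open"

lemma istopology_sphere_open: "istopology sphere_open"
  unfolding istopology_def
proof (intro conjI allI impI)
  fix S T assume S: "sphere_open S" and T: "sphere_open T"
  have 1: "{z. Some z \<in> S \<inter> T} = {z. Some z \<in> S} \<inter> {z. Some z \<in> T}"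
    and 2: "{z. Some z \<notin> S \<inter> T} = {z. Some z \<notin> S} \<union> {z. Some z \<notin> T}"
    by auto
  show "sphere_open (S \<inter> T)"
    using S T unfolding sphere_open_def 1 2 by (auto intro: open_Int compact_Un)
next
  fix K assume K: "\<forall>U\<in>K. sphere_open U"
  have 1: "{z. Some z \<in> \<Union>K} = (\<Union>U\<in>K. {z. Some z \<in> U})"
    by auto
  have op: "open {z. Some z \<in> \<Union>K}"
    unfolding 1 using K by (auto simp: sphere_open_def)
  have "compact {z. Some z \<notin> \<Union>K}" if "None \<in> \<Union>K"
  proof -
    obtain U where U: "U \<in> K" "None \<in> U"
      using \<open>None \<in> \<Union>K\<close> by auto
    have "compact ({z. Some z \<notin> U} \<inter> - {z. Some z \<in> \<Union>K})"
      using K U op by (intro compact_Int_closed) (auto simp: sphere_open_def closed_Compl)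
    also have "{z. Some z \<notin> U} \<inter> - {z. Some z \<in> \<Union>K} = {z. Some z \<notin> \<Union>K}"
      using U by auto
    finally show ?thesis .
  qed
  with op show "sphere_open (\<Union>K)"
    by (auto simp: sphere_open_def)
qed

lemma openin_sphere_topology: "openin sphere_topology = sphere_open"
  by (simp add: sphere_topology_def istopology_sphere_open topology_inverse')

lemma topspace_sphere_topology: "topspace sphere_topology = UNIV"
proof -
  have "openin sphere_topology UNIV"
    by (simp add: openin_sphere_topology sphere_open_def)
  then show ?thesis
    using openin_subset by blast
qed

definition sphere_div :: "complex \<Rightarrow> complex \<Rightarrow> riemann_sphere" where
  "sphere_div a b = (if b = 0 then None else Some (a / b))"

fun sphere_inv :: "riemann_sphere \<Rightarrow> riemann_sphere" where
  "sphere_inv None = Some 0"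
| "sphere_inv (Some z) = sphere_div 1 z"

text \<open>The sphere has the atlas consisting of the coordinates \<open>z\<close> and \<open>1/z\<close>. With \<open>a\<close>, \<open>b\<close> ranging
  over \<^term>\<open>{id, sphere_inv}\<close>, the maps below are the expressions of \<open>F\<close> in these coordinates, each
  on the open set of the plane where it is finite.\<close>

definition chart_dom ::
  "(riemann_sphere \<Rightarrow> riemann_sphere) \<Rightarrow> (riemann_sphere \<Rightarrow> riemann_sphere) \<Rightarrow>
   (riemann_sphere \<Rightarrow> riemann_sphere) \<Rightarrow> complex set" where
  "chart_dom a b F = {z. b (F (a (Some z))) \<noteq> None}"

definition chart_rep ::
  "(riemann_sphere \<Rightarrow> riemann_sphere) \<Rightarrow> (riemann_sphere \<Rightarrow> riemann_sphere) \<Rightarrow>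
   (riemann_sphere \<Rightarrow> riemann_sphere) \<Rightarrow> complex \<Rightarrow> complex" where
  "chart_rep a b F z = the (b (F (a (Some z))))"


section \<open>Sobolev functions on plane open sets\<close>

primrec C_k :: "nat \<Rightarrow> (complex \<Rightarrow> real) \<Rightarrow> bool" where
  "C_k 0 u \<longleftrightarrow> continuous_on UNIV u"
| "C_k (Suc n) u \<longleftrightarrow>
     u differentiable_on UNIV \<and> (\<forall>v. C_k n (\<lambda>z. frechet_derivative u (at z) v))"

definition test_function :: "complex set \<Rightarrow> (complex \<Rightarrow> real) \<Rightarrow> bool" where
  "test_function \<Omega> u \<longleftrightarrow>
     (\<forall>n. C_k n u) \<and> compact (closure {z. u z \<noteq> 0}) \<and> closure {z. u z \<noteq> 0} \<subseteq> \<Omega>"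

definition L2_loc :: "complex set \<Rightarrow> (complex \<Rightarrow> complex) \<Rightarrow> bool" where
  "L2_loc \<Omega> g \<longleftrightarrow>
     set_borel_measurable lborel \<Omega> g \<and>
     (\<forall>K. compact K \<and> K \<subseteq> \<Omega> \<longrightarrow> set_integrable lborel K (\<lambda>z. (cmod (g z))\<^sup>2))"

definition weak_derivative ::
  "complex set \<Rightarrow> (complex \<Rightarrow> complex) \<Rightarrow> complex \<Rightarrow> (complex \<Rightarrow> complex) \<Rightarrow> bool" where
  "weak_derivative \<Omega> g v h \<longleftrightarrow>
     (\<forall>u. test_function \<Omega> u \<longrightarrow>
        (LINT z:\<Omega>|lborel. frechet_derivative u (at z) v *\<^sub>R g z) =
        - (LINT z:\<Omega>|lborel. u z *\<^sub>R h z))"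

text \<open>\<open>g\<close> lies in \<open>W\<^sup>1\<^sup>,\<^sup>2\<close> locally on \<open>\<Omega>\<close>, with weak partial derivatives \<open>gx\<close> and \<open>gy\<close> in the
  real and in the imaginary direction.\<close>

definition W12_loc ::
  "complex set \<Rightarrow> (complex \<Rightarrow> complex) \<Rightarrow> (complex \<Rightarrow> complex) \<Rightarrow> (complex \<Rightarrow> complex) \<Rightarrow> bool" where
  "W12_loc \<Omega> g gx gy \<longleftrightarrow>
     L2_loc \<Omega> g \<and> L2_loc \<Omega> gx \<and> L2_loc \<Omega> gy \<and>
     weak_derivative \<Omega> g 1 gx \<and> weak_derivative \<Omega> g \<i> gy"

definition wirtinger_z :: "complex \<Rightarrow> complex \<Rightarrow> complex" where
  "wirtinger_z p q = (p - \<i> * q) / 2"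

definition wirtinger_zbar :: "complex \<Rightarrow> complex \<Rightarrow> complex" where
  "wirtinger_zbar p q = (p + \<i> * q) / 2"


section \<open>Quasiconformal mappings of the sphere\<close>

text \<open>A homeomorphism of the sphere preserves the orientation if the image of each small positively
  oriented circle winds once in the positive direction about the image of the centre.
  The centres for which a point at infinity is involved (at most two) can be left out, since the
  local degree of a homeomorphism of a connected surface is constant.\<close>

definition sense_preserving :: "(riemann_sphere \<Rightarrow> riemann_sphere) \<Rightarrow> bool" where
  "sense_preserving F \<longleftrightarrow>
     (\<forall>z\<in>chart_dom id id F. \<forall>\<^sub>F r in at_right 0.
        winding_number (chart_rep id id F \<circ> circlepath z r) (chart_rep id id F z) = 1)"

text \<open>Membership in the Sobolev space over the sphere and the dilatation inequality are both
  expressed in the local coordinates; the inequality does not depend on the choice of coordinates.\<close>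

definition quasiconformal :: "real \<Rightarrow> (riemann_sphere \<Rightarrow> riemann_sphere) \<Rightarrow> bool" where
  "quasiconformal k F \<longleftrightarrow>
     0 \<le> k \<and> k < 1 \<and>
     homeomorphic_map sphere_topology sphere_topology F \<and>
     sense_preserving F \<and>
     (\<forall>a\<in>{id, sphere_inv}. \<forall>b\<in>{id, sphere_inv}. \<exists>gx gy.
        W12_loc (chart_dom a b F) (chart_rep a b F) gx gy \<and>
        (AE z in lborel. z \<in> chart_dom a b F \<longrightarrow>
           cmod (wirtinger_zbar (gx z) (gy z)) \<le> k * cmod (wirtinger_z (gx z) (gy z))))"

definition qc_extension ::
  "real \<Rightarrow> complex set \<Rightarrow> (complex \<Rightarrow> complex) \<Rightarrow> (riemann_sphere \<Rightarrow> riemann_sphere) \<Rightarrow> bool" where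
  "qc_extension k \<Omega> f F \<longleftrightarrow>
     open \<Omega> \<and> connected \<Omega> \<and> f holomorphic_on \<Omega> \<and> inj_on f \<Omega> \<and>
     quasiconformal k F \<and> (\<forall>z\<in>\<Omega>. F (Some z) = Some (f z))"


section \<open>The classes of analytic functions\<close>

definition class_A :: "(complex \<Rightarrow> complex) set" where
  "class_A = {f. f holomorphic_on ball 0 1 \<and> f 0 = 0 \<and> deriv f 0 = 1}"

text \<open>The quotient \<open>z / f(z)\<close>, with its removable singularity at the origin filled in.\<close>

definition recip_quot :: "(complex \<Rightarrow> complex) \<Rightarrow> complex \<Rightarrow> complex" where
  "recip_quot f z = (if z = 0 then 1 else z / f z)"

definition U_op :: "(complex \<Rightarrow> complex) \<Rightarrow> complex \<Rightarrow> complex" where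
  "U_op f z = (recip_quot f z)\<^sup>2 * deriv f z - 1"

text \<open>At a zero of \<open>f\<close> other than the origin \<^const>\<open>U_op\<close> should have a pole; by \<open>x / 0 = 0\<close> its value
  there is \<open>-1\<close>. As only \<open>\<lambda> \<le> 1\<close> is considered, the bound below excludes such zeros all the same.\<close>

definition class_U :: "real \<Rightarrow> (complex \<Rightarrow> complex) set" where
  "class_U lam = {f \<in> class_A. \<forall>z\<in>ball 0 1. cmod (U_op f z) < lam}"

definition phi :: "(complex \<Rightarrow> complex) \<Rightarrow> complex \<Rightarrow> complex \<Rightarrow> complex" where
  "phi f a2 z = recip_quot f z + a2 * z - 1"

end

(* The idea of part (1) is to work in the coordinate w = 1/z. With z/f(z) = 1 - a_2 z + z p(z) one has
   U_f(z) = -z^2 p'(z), so the maximum principle gives |p'| <= lambda, and p is lambda-Lipschitz on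
   the closed disc. In the coordinates 1/z the extension becomes G(w) = w - a_2 + p(r(w)), where r
   folds the plane onto the disc (cnj w inside, 1/w outside) and is 1-Lipschitz. So G is the identity
   plus a lambda-contraction up to a translation: it is a homeomorphism by Banach's fixed point
   theorem, its complex dilatation is p'(cnj w) inside the disc and 0 outside, and the images of
   small circles wind once, since G(w) - G(v) stays within lambda |w - v| of w - v.

   In part (2), p = 0, and the extension maps each ray outside the disc affinely onto the outward
   normal of the image disc. It is a C^1 homeomorphism of the plane, whose Wirtinger derivatives at
   the point n e with |e| = 1 <= n are (1 - ae/n)/(1 - ae)^3 and -a e^3 (1 - 1/n)/(1 - ae)^3.

   The weak derivatives of a locally Lipschitz function that is differentiable off a null set are its
   pointwise derivatives, by translation invariance of the integral and dominated convergence. *)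

theory Submission
  imports Defs
begin

section \<open>Locally Lipschitz functions\<close>

text \<open>The Sobolev condition has to be verified in all four pairs of coordinates and across the
  unit circle, where the extension of part (1) need not be differentiable: \<open>p\<close> has only
  Lipschitz boundary values there. The analysis is therefore reduced to two local properties that
  survive composition with \<open>1/z\<close>: \<open>lip_at\<close>, whose constant is local
  because \<open>1/z\<close> has no global one, and a pointwise bound on the derivative off the
  circle and the origin, a null set. Orientation is tested on the circle as well;
  \<open>nearly_linear\<close>, which only keeps difference quotients in a disc away from 0,
  replaces differentiability there. Both extensions are treated as plane homeomorphisms
  \<open>H\<close> that fix infinity: the one of part (2) has this form, the one of part (1)
  acquires it by conjugation with the inversion. At infinity it remains to see that
  \<open>1 / H (1/w)\<close> is Lipschitz at 0. In part (1) this function is \<open>f\<close>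
  itself; in part (2) it contains \<open>|w|\<close>, Lipschitz but not differentiable at 0. For
  \<open>p = 0\<close> the reflected extension is just the Moebius map; the formula of part (2) is
  another extension, one that keeps infinity fixed.\<close>

definition lip_at :: "('a::metric_space \<Rightarrow> 'b::metric_space) \<Rightarrow> 'a \<Rightarrow> bool" where
  "lip_at g z \<longleftrightarrow> (\<exists>r>0. \<exists>L. L-lipschitz_on (ball z r) g)"

lemma lip_at_cong:
  assumes "\<forall>\<^sub>F w in nhds z. f w = g w" and "lip_at g z"
  shows "lip_at f z"
proof -
  obtain d where d: "d > 0" "\<And>w. dist w z < d \<Longrightarrow> f w = g w"
    using assms(1) by (auto simp: eventually_nhds_metric)
  obtain r L where r: "r > 0" "L-lipschitz_on (ball z r) g"
    using assms(2) by (auto simp: lip_at_def)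
  have "L-lipschitz_on (ball z (min d r)) g"
    using r(2) by (rule lipschitz_on_subset) auto
  then have "L-lipschitz_on (ball z (min d r)) f"
    by (rule lipschitz_on_transform) (auto simp: d dist_commute)
  then show ?thesis
    unfolding lip_at_def using d(1) r(1) by (intro exI[of _ "min d r"]) auto
qed

lemma lip_at_continuous:
  assumes "lip_at g z"
  shows "\<forall>\<^sub>F w in nhds z. isCont g w"
proof -
  obtain r L where r: "r > 0" "L-lipschitz_on (ball z r) g"
    using assms by (auto simp: lip_at_def)
  then have "continuous_on (ball z r) g"
    using lipschitz_on_continuous_on by blast
  then have "\<And>w. w \<in> ball z r \<Longrightarrow> isCont g w"
    by (simp add: continuous_on_eq_continuous_at)
  then show ?thesis
    using r(1) eventually_nhds_in_open[of "ball z r" z] by (auto elim: eventually_mono)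
qed

lemma lip_at_isCont: "lip_at g z \<Longrightarrow> isCont g z"
  using lip_at_continuous eventually_nhds_x_imp_x by blast

lemma lip_at_continuous_on: "(\<And>z. z \<in> S \<Longrightarrow> lip_at g z) \<Longrightarrow> continuous_on S g"
  by (meson continuous_at_imp_continuous_on lip_at_isCont)

lemma lip_at_compose:
  assumes "lip_at f z" and "lip_at g (f z)"
  shows "lip_at (\<lambda>w. g (f w)) z"
proof -
  obtain r L where r: "r > 0" "L-lipschitz_on (ball z r) f"
    using assms(1) by (auto simp: lip_at_def)
  obtain s M where s: "s > 0" "M-lipschitz_on (ball (f z) s) g"
    using assms(2) by (auto simp: lip_at_def)
  have "\<forall>\<^sub>F w in nhds z. f w \<in> ball (f z) s"
    using lip_at_isCont[OF assms(1)] s(1)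
    by (intro eventually_compose_filterlim[OF eventually_nhds_in_open])
       (auto simp: isCont_def tendsto_at_iff_tendsto_nhds)
  then obtain d where d: "d > 0" "\<And>w. dist w z < d \<Longrightarrow> f w \<in> ball (f z) s"
    by (auto simp: eventually_nhds_metric)
  have "L-lipschitz_on (ball z (min d r)) f"
    using r(2) by (rule lipschitz_on_subset) auto
  moreover have "M-lipschitz_on (f ` ball z (min d r)) g"
    using s(2) by (rule lipschitz_on_subset) (use d(2) in \<open>auto simp: dist_commute\<close>)
  ultimately have "(M * L)-lipschitz_on (ball z (min d r)) (\<lambda>w. g (f w))"
    by (rule lipschitz_on_compose2)
  then show ?thesis
    unfolding lip_at_def using d(1) r(1) by (intro exI[of _ "min d r"]) auto
qed

lemma lip_at_mult:
  fixes f g :: "'a::metric_space \<Rightarrow> complex"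
  assumes "lip_at f z" and "lip_at g z"
  shows "lip_at (\<lambda>w. f w * g w) z"
proof -
  obtain r L where r: "r > 0" "L-lipschitz_on (ball z r) f"
    using assms(1) by (auto simp: lip_at_def)
  obtain s M where s: "s > 0" "M-lipschitz_on (ball z s) g"
    using assms(2) by (auto simp: lip_at_def)
  have L: "L \<ge> 0" and M: "M \<ge> 0" using r s lipschitz_on_nonneg by auto
  \<comment> \<open>The cap 1 bounds \<open>f\<close> and \<open>g\<close> on the ball by
    \<open>A\<close> and \<open>B\<close>, the modulus at the centre plus the Lipschitz
    constant.\<close>
  define d where "d = min 1 (min r s)"
  define A B where "A = cmod (f z) + L" and "B = cmod (g z) + M"
  have d: "d > 0" "d \<le> 1" "d \<le> r" "d \<le> s" using r s by (auto simp: d_def)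
  have fb: "cmod (f w) \<le> A" if "w \<in> ball z d" for w
  proof -
    have "dist (f w) (f z) \<le> L * dist w z"
      using lipschitz_onD[OF r(2), of w z] that d r(1) by auto
    also have "\<dots> \<le> L * 1" using that d L by (intro mult_left_mono) (auto simp: dist_commute)
    finally show ?thesis
      unfolding A_def dist_norm using norm_triangle_ineq2[of "f w" "f z"] by auto
  qed
  have gb: "cmod (g w) \<le> B" if "w \<in> ball z d" for w
  proof -
    have "dist (g w) (g z) \<le> M * dist w z"
      using lipschitz_onD[OF s(2), of w z] that d s(1) by auto
    also have "\<dots> \<le> M * 1" using that d M by (intro mult_left_mono) (auto simp: dist_commute)
    finally show ?thesis
      unfolding B_def dist_norm using norm_triangle_ineq2[of "g w" "g z"] by auto
  qed
  have AB: "A \<ge> 0" "B \<ge> 0" using L M by (auto simp: A_def B_def)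
  have "(A * M + B * L)-lipschitz_on (ball z d) (\<lambda>w. f w * g w)"
  proof (rule lipschitz_onI)
    fix x y assume xy: "x \<in> ball z d" "y \<in> ball z d"
    have "f x * g x - f y * g y = f x * (g x - g y) + g y * (f x - f y)"
      by (simp add: algebra_simps)
    then have "dist (f x * g x) (f y * g y) \<le> cmod (f x) * dist (g x) (g y) + cmod (g y) * dist (f x) (f y)"
      unfolding dist_norm by (metis norm_mult norm_triangle_ineq)
    also have "\<dots> \<le> A * (M * dist x y) + B * (L * dist x y)"
      using xy d AB by (intro add_mono mult_mono fb gb lipschitz_onD[OF s(2)] lipschitz_onD[OF r(2)]) auto
    finally show "dist (f x * g x) (f y * g y) \<le> (A * M + B * L) * dist x y"
      by (simp add: algebra_simps)
  qed (use AB L M in auto)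
  then show ?thesis
    unfolding lip_at_def using d(1) by auto
qed

lemma lip_at_derivative_bound:
  fixes g :: "'a::real_normed_vector \<Rightarrow> 'b::real_normed_vector"
  assumes "r > 0" and "\<And>w. w \<in> ball z r \<Longrightarrow> (g has_derivative g' w) (at w)"
    and "\<And>w h. w \<in> ball z r \<Longrightarrow> norm (g' w h) \<le> B * norm h"
  shows "lip_at g z"
proof -
  \<comment> \<open>The sign of \<open>B\<close> is unknown, but a Lipschitz constant must be
    nonnegative.\<close>
  have "(max B 0)-lipschitz_on (ball z r) g"
  proof (rule lipschitz_onI)
    fix x y assume xy: "x \<in> ball z r" "y \<in> ball z r"
    have "norm (g x - g y) \<le> max B 0 * norm (x - y)"
    proof (rule differentiable_bound[where f' = g'])
      fix w assume w: "w \<in> ball z r"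
      show "(g has_derivative g' w) (at w within ball z r)"
        using assms(2)[OF w] by (rule has_derivative_at_withinI)
      show "onorm (g' w) \<le> max B 0"
      proof (rule onorm_bound)
        fix h show "norm (g' w h) \<le> max B 0 * norm h"
          using assms(3)[OF w, of h] by (meson order.trans max.cobounded1 mult_right_mono norm_ge_zero)
      qed auto
    qed (use xy in auto)
    then show "dist (g x) (g y) \<le> max B 0 * dist x y" by (simp add: dist_norm)
  qed auto
  then show ?thesis using assms(1) by (auto simp: lip_at_def)
qed

lemma lip_at_holomorphic:
  assumes "f holomorphic_on S" and "open S" and "z \<in> S"
  shows "lip_at f z"
proof -
  obtain r where r: "r > 0" "cball z r \<subseteq> S"
    using assms open_contains_cball by blast
  have "continuous_on (cball z r) (deriv f)"
    using r(2) assms by (meson holomorphic_deriv holomorphic_on_imp_continuous_on continuous_on_subset)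
  then have "compact (deriv f ` cball z r)"
    by (rule compact_continuous_image) auto
  then obtain B where B: "\<And>w. w \<in> cball z r \<Longrightarrow> cmod (deriv f w) \<le> B"
    using compact_imp_bounded bounded_iff by (metis imageI)
  show ?thesis
  proof (rule lip_at_derivative_bound[OF r(1)])
    fix w assume "w \<in> ball z r"
    then have "w \<in> S" using r(2) by auto
    then show "(f has_derivative (\<lambda>h. deriv f w * h)) (at w)"
      using holomorphic_derivI[OF assms(1,2)] by (simp add: has_field_derivative_def)
  next
    fix w h assume "w \<in> ball z r"
    then show "cmod (deriv f w * h) \<le> B * cmod h"
      using B[of w] by (auto simp: norm_mult intro!: mult_right_mono)
  qed
qed

lemma lip_at_inverse: "z \<noteq> 0 \<Longrightarrow> lip_at (\<lambda>w::complex. 1 / w) z"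
  by (rule lip_at_holomorphic[of _ "- {0}"]) (auto intro!: holomorphic_intros)

lemma lipschitz_on_UNIV_imp_lip_at: "L-lipschitz_on UNIV g \<Longrightarrow> lip_at g z"
  unfolding lip_at_def by (meson lipschitz_on_subset subset_UNIV zero_less_one)

text \<open>Local Lipschitz bounds become uniform on the compact closed
  \<open>\<epsilon>\<close>-neighbourhood of \<open>K\<close>. The point \<open>w\<close> may thus
  leave \<open>K\<close>, as the shifted points in difference quotients do.\<close>

lemma lip_at_uniform_on_compact:
  fixes g :: "'a::{real_normed_vector,heine_borel} \<Rightarrow> 'b::real_normed_vector"
  assumes "open \<Omega>" and "\<And>z. z \<in> \<Omega> \<Longrightarrow> lip_at g z" and "compact K" and "K \<subseteq> \<Omega>"
  obtains \<epsilon> L where "\<epsilon> > 0" and "0 \<le> L"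
    and "\<And>z w. z \<in> K \<Longrightarrow> dist z w \<le> \<epsilon> \<Longrightarrow> w \<in> \<Omega>"
    and "\<And>z w. z \<in> K \<Longrightarrow> dist z w \<le> \<epsilon> \<Longrightarrow> norm (g w - g z) \<le> L * norm (w - z)"
proof -
  obtain \<epsilon> where e: "\<epsilon> > 0" "(\<Union>x\<in>K. cball x \<epsilon>) \<subseteq> \<Omega>"
    using compact_subset_open_imp_cball_epsilon_subset assms by metis
  define K' where "K' = (\<Union>x\<in>K. cball x \<epsilon>)"
  have "compact K'"
    unfolding K'_def using assms(3) by (rule compact_minkowski_sum_cball)
  \<comment> \<open>\<open>local_lipschitz\<close> carries a time parameter, which is frozen here at
    a single dummy value.\<close>
  moreover have "local_lipschitz {0::real} K' (\<lambda>_. g)"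
  proof (rule local_lipschitzI)
    fix t :: real and x assume "x \<in> K'"
    then have "x \<in> \<Omega>" using e(2) unfolding K'_def by blast
    then have "lip_at g x" by (rule assms(2))
    then obtain r L where r: "r > 0" "L-lipschitz_on (ball x r) g"
      by (auto simp: lip_at_def)
    have "L-lipschitz_on (cball x (r/2) \<inter> K') g"
      using r(2) by (rule lipschitz_on_subset) (use r(1) in auto)
    then show "\<exists>u>0. \<exists>L. \<forall>t\<in>cball t u \<inter> {0}. L-lipschitz_on (cball x u \<inter> K') g"
      using r(1) by (intro exI[of _ "r/2"]) auto
  qed
  ultimately obtain L where L: "L-lipschitz_on K' g"
    using local_lipschitz_compact_implies_lipschitz[where X = K' and T = "{0::real}" and f = "\<lambda>_. g"]
    by (auto simp: continuous_on_const)
  show ?thesis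
  proof (rule that[OF e(1) lipschitz_on_nonneg[OF L]])
    fix z w assume zw: "z \<in> K" "dist z w \<le> \<epsilon>"
    then show "w \<in> \<Omega>" using e by fastforce
    have "w \<in> K'" "z \<in> K'" using zw e(1) by (auto simp: K'_def intro!: bexI[of _ z])
    then show "norm (g w - g z) \<le> L * norm (w - z)"
      using lipschitz_onD[OF L, of w z] by (simp add: dist_norm)
  qed
qed

section \<open>Weak derivatives of locally Lipschitz functions\<close>

lemma test_functionD:
  assumes "test_function \<Omega> u"
  shows "u differentiable (at z)"
    and "continuous_on UNIV u"
    and "continuous_on UNIV (\<lambda>z. frechet_derivative u (at z) v)"
    and "compact (closure {z. u z \<noteq> 0})" and "closure {z. u z \<noteq> 0} \<subseteq> \<Omega>"
proof -
  have *: "\<And>n. C_k n u" using assms by (simp add: test_function_def)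
  from *[of 0] show "continuous_on UNIV u" by simp
  from *[of 1] show "u differentiable (at z)"
    by (auto simp: differentiable_on_def)
  from *[of 1] show "continuous_on UNIV (\<lambda>z. frechet_derivative u (at z) v)"
    by simp
qed (use assms in \<open>auto simp: test_function_def\<close>)

text \<open>A test function comes with continuity of each directional derivative separately.
  Linearity reduces all directions to \<open>1\<close> and \<open>\<i>\<close>, and the derivatives
  in these two are bounded on the unit ball around \<open>z\<close>.\<close>

lemma lip_at_test_function:
  assumes "test_function \<Omega> u"
  shows "lip_at u z"
proof -
  define D where "D = (\<lambda>w. frechet_derivative u (at w))"
  have der: "(u has_derivative D w) (at w)" for w
    unfolding D_def using test_functionD(1)[OF assms] frechet_derivative_works by blast
  have dec: "D w h = Re h * D w 1 + Im h * D w \<i>" for w h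
  proof -
    interpret linear "D w" using der has_derivative_linear by blast
    have "D w h = D w (Re h *\<^sub>R 1 + Im h *\<^sub>R \<i>)"
      by (metis complex_eq scaleR_conv_of_real mult.commute mult.right_neutral)
    then show ?thesis by (simp add: add scale)
  qed
  have "compact ((\<lambda>w. D w v) ` cball z 1)" for v
    unfolding D_def
    by (intro compact_continuous_image continuous_on_subset[OF test_functionD(3)[OF assms]]) auto
  then have "\<exists>B. \<forall>w\<in>cball z 1. \<bar>D w v\<bar> \<le> B" for v
    using compact_imp_bounded[of "(\<lambda>w. D w v) ` cball z 1"] by (auto simp: bounded_iff)
  then obtain B where B: "\<And>v w. w \<in> cball z 1 \<Longrightarrow> \<bar>D w v\<bar> \<le> B v" by metis
  show ?thesis
  proof (rule lip_at_derivative_bound[of 1, OF _ der])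
    fix w h assume w: "w \<in> ball z 1"
    have "\<bar>D w h\<bar> \<le> \<bar>Re h\<bar> * \<bar>D w 1\<bar> + \<bar>Im h\<bar> * \<bar>D w \<i>\<bar>"
      unfolding dec[of w h] by (metis abs_mult abs_triangle_ineq)
    also have "\<dots> \<le> cmod h * B 1 + cmod h * B \<i>"
      using w B by (intro add_mono mult_mono abs_Re_le_cmod abs_Im_le_cmod) auto
    finally show "norm (D w h) \<le> (B 1 + B \<i>) * norm h"
      by (simp add: algebra_simps)
  qed auto
qed

lemma LBINT_translation:
  fixes f :: "complex \<Rightarrow> complex"
  assumes "f \<in> borel_measurable lborel"
  shows "(LINT z|lborel. f (z + c)) = (LINT z|lborel. f z)"
    and "integrable lborel f \<Longrightarrow> integrable lborel (\<lambda>z. f (z + c))"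
proof -
  have "(LINT z|distr lborel borel ((+) c). f z) = (LINT z|lborel. f (c + z))"
    using assms by (intro integral_distr) auto
  then show "(LINT z|lborel. f (z + c)) = (LINT z|lborel. f z)"
    by (simp add: lborel_distr_plus add.commute)
  assume "integrable lborel f"
  then have "integrable (distr lborel borel ((+) c)) f"
    by (simp add: lborel_distr_plus)
  then show "integrable lborel (\<lambda>z. f (z + c))"
    using assms by (subst (asm) integrable_distr_eq) (auto simp: add.commute)
qed

text \<open>The step runs through the sequence \<open>1/(n+1)\<close>, because measurability of
  limits and dominated convergence both ask for sequences.\<close>

lemma has_derivative_imp_difference_quotient_LIMSEQ:
  fixes g :: "complex \<Rightarrow> complex"
  assumes "(g has_derivative D) (at z)"
  shows "(\<lambda>n. of_nat (Suc n) * (g (z + of_real (inverse (Suc n)) * v) - g z)) \<longlonglongrightarrow> D v"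
proof -
  interpret linear D using assms has_derivative_linear by blast
  have "((\<lambda>t::real. g (z + of_real t * v)) has_derivative (\<lambda>t. D (of_real t * v))) (at 0)"
    by (rule has_derivative_compose[of "\<lambda>t. z + of_real t * v" _ _ _ g, simplified])
       (auto intro!: derivative_eq_intros assms)
  moreover have "(\<lambda>t::real. D (of_real t * v)) = (\<lambda>t. t *\<^sub>R D v)"
    by (metis scale scaleR_conv_of_real)
  ultimately have "((\<lambda>t::real. g (z + of_real t * v)) has_vector_derivative D v) (at 0)"
    by (simp add: has_vector_derivative_def)
  then have "(\<lambda>t. norm (g (z + of_real t * v) - g z - t *\<^sub>R D v) / norm t) \<midarrow>0\<rightarrow> 0"
    by (simp add: has_vector_derivative_def has_derivative_at)
  moreover have "norm (g (z + of_real t * v) - g z - t *\<^sub>R D v) / norm t =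
      norm ((1/t) *\<^sub>R (g (z + of_real t * v) - g z) - D v)" if "t \<noteq> 0" for t :: real
  proof -
    have "(1/t) *\<^sub>R (g (z + of_real t * v) - g z) - D v = (1/t) *\<^sub>R (g (z + of_real t * v) - g z - t *\<^sub>R D v)"
      using that by (simp add: scaleR_diff_right)
    then show ?thesis by (simp add: divide_simps)
  qed
  ultimately have "(\<lambda>t. norm ((1/t) *\<^sub>R (g (z + of_real t * v) - g z) - D v)) \<midarrow>0\<rightarrow> 0"
    by (subst (asm) LIM_cong) auto
  then have "((\<lambda>t::real. (1/t) *\<^sub>R (g (z + of_real t * v) - g z)) \<longlongrightarrow> D v) (at 0)"
    by (simp add: tendsto_norm_zero_iff LIM_zero_iff)
  then have "(\<lambda>n. (1 / inverse (real (Suc n))) *\<^sub>R (g (z + of_real (inverse (real (Suc n))) * v) - g z)) \<longlonglongrightarrow> D v"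
    by (rule filterlim_compose)
       (auto simp: filterlim_at LIMSEQ_inverse_real_of_nat simp del: of_nat_Suc)
  then show ?thesis
    by (simp add: scaleR_conv_of_real field_simps)
qed

text \<open>Differentiation under the integral sign applied to the constant function
  \<open>t \<mapsto> \<integral> W(z + tv) dz\<close>.\<close>

lemma LBINT_derivative_eq_0:
  fixes W :: "complex \<Rightarrow> complex"
  assumes lip: "\<And>z. lip_at W z" and "bounded {z. W z \<noteq> 0}"
    and D: "AE z in lborel. (W has_derivative D z) (at z)"
    and meas: "(\<lambda>z. D z v) \<in> borel_measurable lborel"
  shows "integrable lborel (\<lambda>z. D z v)" and "(LINT z|lborel. D z v) = 0"
proof -
  obtain M where M: "\<And>z. W z \<noteq> 0 \<Longrightarrow> cmod z \<le> M"
    using assms(2) by (auto simp: bounded_iff)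
  \<comment> \<open>The ball is enlarged by \<open>cmod v\<close> so that for \<open>z\<close>
    outside it \<open>W\<close> vanishes at \<open>z\<close> and at all \<open>z + t v\<close> with
    \<open>0 < t \<le> 1\<close>.\<close>
  define K where "K = cball (0::complex) (M + cmod v)"
  have cW: "continuous_on UNIV W" by (rule lip_at_continuous_on) (rule lip)
  have mW: "W \<in> borel_measurable lborel" using cW borel_measurable_continuous_onI by simp
  have iW: "integrable lborel W"
  proof -
    have "integrable lborel (\<lambda>z. indicator K z *\<^sub>R W z)"
      by (intro borel_integrable_compact continuous_on_subset[OF cW]) (auto simp: K_def)
    also have "(\<lambda>z. indicator K z *\<^sub>R W z) = W"
      using M by (auto simp: K_def indicator_def fun_eq_iff)
         (smt (verit) norm_ge_zero)
    finally show ?thesis .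
  qed
  obtain \<epsilon> L where e: "\<epsilon> > 0" "0 \<le> L"
    "\<And>z w. z \<in> K \<Longrightarrow> dist z w \<le> \<epsilon> \<Longrightarrow> cmod (W w - W z) \<le> L * cmod (w - z)"
    using lip_at_uniform_on_compact[of UNIV W K] lip by (auto simp: K_def)
  define t where "t = (\<lambda>n. inverse (real (Suc n)))"
  have t: "0 < t n" "t n \<le> 1" for n by (auto simp: t_def inverse_le_1_iff)
  have tlim: "(\<lambda>n. t n * cmod v) \<longlonglongrightarrow> 0"
    unfolding t_def using tendsto_mult_left_zero[OF LIMSEQ_inverse_real_of_nat] by simp
  then obtain n0 where n0: "\<And>n. n \<ge> n0 \<Longrightarrow> t n * cmod v \<le> \<epsilon>"
    using order_tendstoD(2)[OF tlim e(1)] unfolding eventually_sequentially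
    by (meson less_imp_le)
  \<comment> \<open>The shift by \<open>n0\<close> makes every step at most
    \<open>\<epsilon>\<close> long, so that one integrable bound dominates all terms of the
    sequence.\<close>
  define s where "s = (\<lambda>n z. of_nat (Suc (n + n0)) * (W (z + of_real (t (n + n0)) * v) - W z))"
  have si: "integrable lborel (s n)" and sI: "(LINT z|lborel. s n z) = 0" for n
    unfolding s_def using LBINT_translation[OF mW] iW by (auto simp: integral_mult_right_zero)
  have bound: "cmod (s n z) \<le> indicator K z * (L * cmod v)" for n z
  proof (cases "z \<in> K")
    case True
    have "cmod (W (z + of_real (t (n + n0)) * v) - W z) \<le> L * cmod (of_real (t (n + n0)) * v)"
      using e(3)[OF True, of "z + of_real (t (n + n0)) * v"] n0[of "n + n0"] t[of "n + n0"]
      by (simp add: dist_norm norm_mult)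
    then have "cmod (s n z) \<le> real (Suc (n + n0)) * (L * (t (n + n0) * cmod v))"
      unfolding s_def norm_mult using t[of "n+n0"] by (intro mult_mono) (auto simp: norm_mult simp del: of_nat_Suc)
    also have "\<dots> = L * cmod v" by (simp add: t_def field_simps)
    finally show ?thesis using True by simp
  next
    case False
    then have z: "cmod z > M + cmod v" by (simp add: K_def)
    have "cmod (of_real (t (n + n0)) * v) \<le> cmod v"
      using t[of "n + n0"] by (simp add: norm_mult mult_left_le_one_le)
    then have "cmod (z + of_real (t (n + n0)) * v) > M"
      using z norm_diff_ineq[of z "of_real (t (n + n0)) * v"] by linarith
    moreover have "cmod z > M" using z by (smt (verit) norm_ge_zero)
    ultimately have "W z = 0" "W (z + of_real (t (n + n0)) * v) = 0"
      using M not_less by blast+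
    then show ?thesis using e(2) by (simp add: s_def)
  qed
  have "integrable lborel (\<lambda>z. indicator K z *\<^sub>R (L * cmod v))"
    by (intro borel_integrable_compact) (auto simp: K_def)
  then have iK: "integrable lborel (\<lambda>z. indicator K z * (L * cmod v))" by simp
  have lim: "AE z in lborel. (\<lambda>n. s n z) \<longlonglongrightarrow> D z v"
    using D
  proof eventually_elim
    fix z assume "(W has_derivative D z) (at z)"
    from LIMSEQ_ignore_initial_segment[OF has_derivative_imp_difference_quotient_LIMSEQ[OF this, of v], of n0]
    show "(\<lambda>n. s n z) \<longlonglongrightarrow> D z v" by (simp add: s_def t_def)
  qed
  have ms: "s n \<in> borel_measurable lborel" for n using si[of n] by (rule borel_measurable_integrable)
  have bound': "AE z in lborel. cmod (s n z) \<le> indicator K z * (L * cmod v)" for n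
    using bound by simp
  show "integrable lborel (\<lambda>z. D z v)"
    by (rule integrable_dominated_convergence[OF meas ms iK lim bound'])
  have "(\<lambda>n. LINT z|lborel. s n z) \<longlonglongrightarrow> (LINT z|lborel. D z v)"
    by (rule integral_dominated_convergence[OF meas ms iK lim bound'])
  then show "(LINT z|lborel. D z v) = 0"
    by (simp add: sI LIMSEQ_const_iff)
qed

text \<open>The value 0 on \<open>N\<close> and off \<open>\<Omega>\<close> makes this a function on
  the whole plane that is a pointwise limit everywhere, hence measurable.\<close>

definition piecewise_derivative ::
  "complex set \<Rightarrow> complex set \<Rightarrow> (complex \<Rightarrow> complex \<Rightarrow> complex) \<Rightarrow> complex \<Rightarrow> complex \<Rightarrow> complex" where
  "piecewise_derivative \<Omega> N D v z = (if z \<in> \<Omega> - N then D z v else 0)"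

context
  fixes \<Omega> N :: "complex set" and g :: "complex \<Rightarrow> complex" and D :: "complex \<Rightarrow> complex \<Rightarrow> complex"
  assumes op: "open \<Omega>" and cl: "closed N" and null: "N \<in> null_sets lborel"
    and lip: "\<And>z. z \<in> \<Omega> \<Longrightarrow> lip_at g z"
    and der: "\<And>z. z \<in> \<Omega> - N \<Longrightarrow> (g has_derivative D z) (at z)"
begin

lemma pw_continuous_on: "continuous_on \<Omega> g"
  by (rule lip_at_continuous_on) (rule lip)

lemma pw_derivative_measurable: "piecewise_derivative \<Omega> N D v \<in> borel_measurable lborel"
proof (rule borel_measurable_LIMSEQ_metric)
  \<comment> \<open>\<open>g\<close> is cut off outside \<open>\<Omega>\<close> because the shifted
    point may leave \<open>\<Omega>\<close>; for a given \<open>z\<close> in the open set this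
    happens for finitely many \<open>n\<close> only.\<close>
  define G where "G = (\<lambda>z. indicator \<Omega> z *\<^sub>R g z)"
  define s where "s = (\<lambda>n z. indicator (\<Omega> - N) z *\<^sub>R
    (of_nat (Suc n) * (G (z + of_real (inverse (Suc n)) * v) - G z)))"
  have [measurable]: "G \<in> borel_measurable borel"
    unfolding G_def using op pw_continuous_on
    by (intro borel_measurable_continuous_on_indicator) auto
  have [measurable]: "\<Omega> \<in> sets borel" "N \<in> sets borel"
    using op cl by auto
  show "s n \<in> borel_measurable lborel" for n
    unfolding s_def by measurable
  fix z
  show "(\<lambda>n. s n z) \<longlonglongrightarrow> piecewise_derivative \<Omega> N D v z"
  proof (cases "z \<in> \<Omega> - N")
    case True
    have "(\<lambda>n. z + of_real (inverse (real (Suc n))) * v) \<longlonglongrightarrow> z + of_real 0 * v"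
      by (intro tendsto_intros LIMSEQ_inverse_real_of_nat)
    then have "\<forall>\<^sub>F n in sequentially. z + of_real (inverse (real (Suc n))) * v \<in> \<Omega>"
      using op True by (auto simp: tendsto_def)
    then have "\<forall>\<^sub>F n in sequentially. of_nat (Suc n) * (g (z + of_real (inverse (Suc n)) * v) - g z) = s n z"
      using True by (auto simp: s_def G_def elim!: eventually_mono)
    from Lim_transform_eventually[OF has_derivative_imp_difference_quotient_LIMSEQ[OF der[OF True]] this]
    show ?thesis using True by (simp add: piecewise_derivative_def)
  qed (auto simp: s_def piecewise_derivative_def)
qed

text \<open>The derivative is a limit of difference quotients, which are eventually bounded by
  \<open>cmod v\<close> times a Lipschitz constant valid near \<open>K\<close>. Local square
  integrability rests on this.\<close>

lemma pw_derivative_bounded_on_compact: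
  assumes "compact K" and "K \<subseteq> \<Omega>"
  obtains B where "0 \<le> B" and "\<And>z. z \<in> K \<Longrightarrow> cmod (piecewise_derivative \<Omega> N D v z) \<le> B"
proof -
  obtain \<epsilon> L where e: "\<epsilon> > 0" "0 \<le> L"
    "\<And>z w. z \<in> K \<Longrightarrow> dist z w \<le> \<epsilon> \<Longrightarrow> cmod (g w - g z) \<le> L * cmod (w - z)"
    using lip_at_uniform_on_compact[OF op lip assms] by metis
  show ?thesis
  proof (rule that)
    show "0 \<le> L * cmod v" using e(2) by simp
    fix z assume z: "z \<in> K"
    show "cmod (piecewise_derivative \<Omega> N D v z) \<le> L * cmod v"
    proof (cases "z \<in> \<Omega> - N")
      case True
      have "(\<lambda>n. inverse (real (Suc n)) * cmod v) \<longlonglongrightarrow> 0 * cmod v"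
        by (intro tendsto_intros LIMSEQ_inverse_real_of_nat)
      then have "\<forall>\<^sub>F n in sequentially. inverse (real (Suc n)) * cmod v < \<epsilon>"
        using order_tendstoD(2) e(1) by fastforce
      then have "\<forall>\<^sub>F n in sequentially.
        cmod (of_nat (Suc n) * (g (z + of_real (inverse (Suc n)) * v) - g z)) \<le> L * cmod v"
      proof eventually_elim
        fix n assume n: "inverse (real (Suc n)) * cmod v < \<epsilon>"
        have "cmod (g (z + of_real (inverse (Suc n)) * v) - g z) \<le> L * (inverse (Suc n) * cmod v)"
          using e(3)[OF z, of "z + of_real (inverse (Suc n)) * v"] n
          by (simp add: dist_norm norm_mult norm_inverse del: of_nat_Suc)
        then have "real (Suc n) * cmod (g (z + of_real (inverse (Suc n)) * v) - g z)
            \<le> real (Suc n) * (L * (inverse (Suc n) * cmod v))"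
          by (intro mult_left_mono) auto
        also have "\<dots> = L * cmod v" by (simp add: field_simps)
        finally show "cmod (of_nat (Suc n) * (g (z + of_real (inverse (Suc n)) * v) - g z)) \<le> L * cmod v"
          by (simp add: norm_mult del: of_nat_Suc)
      qed
      then show ?thesis
        using True tendsto_upperbound[OF tendsto_norm[OF has_derivative_imp_difference_quotient_LIMSEQ[OF der[OF True]]]]
        by (simp add: piecewise_derivative_def)
    qed (use e(2) in \<open>auto simp: piecewise_derivative_def\<close>)
  qed
qed

lemma L2_loc_pw_derivative: "L2_loc \<Omega> (piecewise_derivative \<Omega> N D v)"
  unfolding L2_loc_def
proof (intro conjI allI impI)
  note [measurable] = pw_derivative_measurable
  have [measurable]: "\<Omega> \<in> sets borel" using op by auto
  show "set_borel_measurable lborel \<Omega> (piecewise_derivative \<Omega> N D v)"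
    unfolding set_borel_measurable_def by measurable
  fix K assume K: "compact K \<and> K \<subseteq> \<Omega>"
  then obtain B where B: "0 \<le> B" "\<And>z. z \<in> K \<Longrightarrow> cmod (piecewise_derivative \<Omega> N D v z) \<le> B"
    using pw_derivative_bounded_on_compact by metis
  have [measurable]: "K \<in> sets borel" using K borel_compact by auto
  have "integrable lborel (\<lambda>z. indicator K z *\<^sub>R B\<^sup>2)"
    using K by (intro borel_integrable_compact) auto
  then show "set_integrable lborel K (\<lambda>z. (cmod (piecewise_derivative \<Omega> N D v z))\<^sup>2)"
    unfolding set_integrable_def
    by (rule Bochner_Integration.integrable_bound)
       (use B in \<open>auto simp: indicator_def intro!: power_mono\<close>)
qed

lemma L2_loc_pw: "L2_loc \<Omega> g"
  unfolding L2_loc_def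
proof (intro conjI allI impI)
  show "set_borel_measurable lborel \<Omega> g"
    unfolding set_borel_measurable_def using op pw_continuous_on
    by (simp add: borel_measurable_continuous_on_indicator)
  fix K assume K: "compact K \<and> K \<subseteq> \<Omega>"
  then show "set_integrable lborel K (\<lambda>z. (cmod (g z))\<^sup>2)"
    unfolding set_integrable_def
    by (intro borel_integrable_compact continuous_intros continuous_on_subset[OF pw_continuous_on]) auto
qed

text \<open>Integration by parts: the product of the test function and \<open>g\<close>, extended by
  0, is locally Lipschitz with compact support, so its derivative has integral 0, and the product
  rule splits that derivative into \<open>A + B\<close>.\<close>

lemma weak_derivative_pw: "weak_derivative \<Omega> g v (piecewise_derivative \<Omega> N D v)"
  unfolding weak_derivative_def
proof (intro allI impI)
  fix u assume u: "test_function \<Omega> u"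
  define S where "S = closure {z. u z \<noteq> 0}"
  have S: "compact S" "S \<subseteq> \<Omega>" using test_functionD[OF u] by (auto simp: S_def)
  have uS: "z \<notin> S \<Longrightarrow> u z = 0" for z
    using closure_subset[of "{z. u z \<noteq> 0}"] by (auto simp: S_def)
  define u' where "u' = (\<lambda>z. frechet_derivative u (at z))"
  have du: "(u has_derivative u' z) (at z)" for z
    unfolding u'_def using test_functionD(1)[OF u] frechet_derivative_works by blast
  have opS: "open (- S)" using S compact_imp_closed by blast
  \<comment> \<open>Off its closed support \<open>u\<close> vanishes on an open set, so the
    derivative vanishes too and \<open>A\<close> lives on the compact set \<open>S\<close>.\<close>
  have u'S: "u' z = (\<lambda>h. 0)" if "z \<notin> S" for z
  proof -
    have "(u has_derivative (\<lambda>h. 0)) (at z)"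
      by (rule has_derivative_transform_within_open[of "\<lambda>_. 0" _ _ _ "- S"])
         (use opS that uS in auto)
    then show ?thesis using du has_derivative_unique by blast
  qed
  define A where "A = (\<lambda>z. indicator \<Omega> z *\<^sub>R (u' z v *\<^sub>R g z))"
  define B where "B = (\<lambda>z. indicator \<Omega> z *\<^sub>R (u z *\<^sub>R piecewise_derivative \<Omega> N D v z))"
  have intA: "integrable lborel A"
  proof -
    have "integrable lborel (\<lambda>z. indicator S z *\<^sub>R (u' z v *\<^sub>R g z))"
      unfolding u'_def using S
      by (intro borel_integrable_compact continuous_intros continuous_on_subset[OF pw_continuous_on]
         continuous_on_subset[OF test_functionD(3)[OF u]]) auto
    also have "(\<lambda>z. indicator S z *\<^sub>R (u' z v *\<^sub>R g z)) = A"
      using S(2) u'S by (auto simp: A_def fun_eq_iff indicator_def)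
    finally show ?thesis .
  qed
  have intB: "integrable lborel B"
  proof -
    note [measurable] = pw_derivative_measurable
    have [measurable]: "\<Omega> \<in> sets borel" using op by auto
    have [measurable]: "u \<in> borel_measurable borel"
      using test_functionD(2)[OF u] by (rule borel_measurable_continuous_onI)
    obtain C where C: "0 \<le> C" "\<And>z. z \<in> S \<Longrightarrow> cmod (piecewise_derivative \<Omega> N D v z) \<le> C"
      using pw_derivative_bounded_on_compact[OF S] by metis
    have "compact (u ` S)"
      using S by (intro compact_continuous_image continuous_on_subset[OF test_functionD(2)[OF u]]) auto
    then obtain E where E: "\<And>z. z \<in> S \<Longrightarrow> \<bar>u z\<bar> \<le> E"
      using compact_imp_bounded[of "u ` S"] by (auto simp: bounded_iff)
    have "integrable lborel (\<lambda>z. indicator S z *\<^sub>R (E * C))"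
      using S by (intro borel_integrable_compact) auto
    then show ?thesis
    proof (rule Bochner_Integration.integrable_bound)
      show "B \<in> borel_measurable lborel" unfolding B_def by measurable
      show "AE z in lborel. cmod (B z) \<le> norm (indicator S z *\<^sub>R (E * C))"
      proof (rule AE_I2)
        fix z show "cmod (B z) \<le> norm (indicator S z *\<^sub>R (E * C))"
        proof (cases "z \<in> S")
          case True
          then have "\<bar>u z\<bar> * cmod (piecewise_derivative \<Omega> N D v z) \<le> E * C"
            using E C by (intro mult_mono) (auto intro: order_trans[OF abs_ge_zero])
          also have "\<dots> \<le> \<bar>E * C\<bar>" by simp
          finally show ?thesis
            using True S(2) by (auto simp: B_def)
        qed (simp add: B_def uS)
      qed
    qed
  qed
  define W where "W = (\<lambda>z. if z \<in> \<Omega> then of_real (u z) * g z else 0)"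
  have W0: "W z = 0" if "z \<notin> S" for z using that uS by (simp add: W_def)
  define DW where "DW = (\<lambda>z h. if z \<in> \<Omega> then u' z h *\<^sub>R g z + u z *\<^sub>R piecewise_derivative \<Omega> N D h z else 0)"
  have "(LINT z|lborel. DW z v) = 0"
  proof (rule LBINT_derivative_eq_0)
    fix z
    show "lip_at W z"
    \<comment> \<open>The open sets \<open>\<Omega>\<close> and \<open>- S\<close> cover the plane,
      and \<open>W\<close> is 0 on the second.\<close>
    proof (cases "z \<in> \<Omega>")
      case True
      have "lip_at (\<lambda>z. complex_of_real (u z)) z"
        by (rule lip_at_compose[OF lip_at_test_function[OF u] lipschitz_on_UNIV_imp_lip_at[of 1]])
           (auto simp: lipschitz_on_def dist_norm simp flip: of_real_diff)
      then have "lip_at (\<lambda>z. of_real (u z) * g z) z"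
        using True lip by (intro lip_at_mult) auto
      then show ?thesis
        by (rule lip_at_cong[rotated])
           (use True op in \<open>auto simp: W_def eventually_nhds intro!: exI[of _ \<Omega>]\<close>)
    next
      case False
      then have "\<forall>\<^sub>F w in nhds z. W w = 0"
        using opS S(2) W0 by (auto simp: eventually_nhds intro!: exI[of _ "- S"])
      then show ?thesis
        by (rule lip_at_cong) (auto intro!: lipschitz_on_UNIV_imp_lip_at[of 0] simp: lipschitz_on_def)
    qed
  next
    show "bounded {z. W z \<noteq> 0}"
      using W0 by (intro bounded_subset[OF compact_imp_bounded[OF S(1)]]) auto
    show "(\<lambda>z. DW z v) \<in> borel_measurable lborel"
    proof -
      have "(\<lambda>z. DW z v) = (\<lambda>z. A z + B z)"
        by (auto simp: DW_def A_def B_def fun_eq_iff)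
      then show ?thesis using intA intB by auto
    qed
    have "AE z in lborel. z \<notin> N" using null by (rule AE_not_in)
    then show "AE z in lborel. (W has_derivative DW z) (at z)"
    proof eventually_elim
      fix z assume z: "z \<notin> N"
      show "(W has_derivative DW z) (at z)"
      proof (cases "z \<in> \<Omega>")
        case True
        have "((\<lambda>z. u z *\<^sub>R g z) has_derivative (\<lambda>h. u z *\<^sub>R D z h + u' z h *\<^sub>R g z)) (at z)"
          using True z by (intro has_derivative_scaleR du der) auto
        also have "(\<lambda>h. u z *\<^sub>R D z h + u' z h *\<^sub>R g z) = DW z"
          using True z by (auto simp: DW_def piecewise_derivative_def)
        finally show ?thesis
          by (rule has_derivative_transform_within_open[OF _ op True])
             (auto simp: W_def scaleR_conv_of_real)
      next
        case False
        have "(W has_derivative (\<lambda>h. 0)) (at z)"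
          by (rule has_derivative_transform_within_open[of "\<lambda>_. 0" _ _ _ "- S"])
             (use False opS S(2) W0 in auto)
        then show ?thesis using False by (simp add: DW_def)
      qed
    qed
  qed
  also have "(LINT z|lborel. DW z v) = (LINT z|lborel. A z + B z)"
    by (intro Bochner_Integration.integral_cong) (auto simp: DW_def A_def B_def)
  also have "\<dots> = (LINT z|lborel. A z) + (LINT z|lborel. B z)"
    by (rule Bochner_Integration.integral_add[OF intA intB])
  finally have "(LINT z|lborel. A z) = - (LINT z|lborel. B z)"
    by (simp add: eq_neg_iff_add_eq_0)
  then show "(LINT z:\<Omega>|lborel. frechet_derivative u (at z) v *\<^sub>R g z) =
        - (LINT z:\<Omega>|lborel. u z *\<^sub>R piecewise_derivative \<Omega> N D v z)"
    by (simp add: A_def B_def u'_def set_lebesgue_integral_def)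
qed

lemma W12_loc_pw: "W12_loc \<Omega> g (piecewise_derivative \<Omega> N D 1) (piecewise_derivative \<Omega> N D \<i>)"
  unfolding W12_loc_def
  by (intro conjI L2_loc_pw L2_loc_pw_derivative weak_derivative_pw)

end

section \<open>Pointwise dilatation\<close>

text \<open>\<open>\<alpha>\<close> and \<open>\<beta>\<close> are the Wirtinger derivatives of
  \<open>g\<close> at \<open>z\<close>. Composition with a holomorphic map on either side multiplies
  both by factors of equal modulus, so the condition passes to other coordinates.\<close>

definition dilatation_le_at :: "real \<Rightarrow> (complex \<Rightarrow> complex) \<Rightarrow> complex \<Rightarrow> bool" where
  "dilatation_le_at k g z \<longleftrightarrow> (\<exists>\<alpha> \<beta>. cmod \<beta> \<le> k * cmod \<alpha> \<and> (g has_derivative (\<lambda>h. \<alpha> * h + \<beta> * cnj h)) (at z))"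

lemma dilatation_le_at_cong:
  assumes "\<forall>\<^sub>F w in nhds z. f w = g w" and "dilatation_le_at k g z"
  shows "dilatation_le_at k f z"
proof -
  obtain S where S: "open S" "z \<in> S" "\<And>w. w \<in> S \<Longrightarrow> f w = g w"
    using assms(1) by (auto simp: eventually_nhds)
  obtain \<alpha> \<beta> where ab: "cmod \<beta> \<le> k * cmod \<alpha>" "(g has_derivative (\<lambda>h. \<alpha> * h + \<beta> * cnj h)) (at z)"
    using assms(2) by (auto simp: dilatation_le_at_def)
  have "(f has_derivative (\<lambda>h. \<alpha> * h + \<beta> * cnj h)) (at z)"
    by (rule has_derivative_transform_within_open[OF ab(2) S(1,2)]) (simp add: S(3))
  with ab(1) show ?thesis unfolding dilatation_le_at_def by blast
qed

lemma dilatation_le_at_field_compose: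
  assumes "dilatation_le_at k g z" and "(\<phi> has_field_derivative d) (at (g z))"
  shows "dilatation_le_at k (\<lambda>w. \<phi> (g w)) z"
proof -
  obtain \<alpha> \<beta> where ab: "cmod \<beta> \<le> k * cmod \<alpha>" "(g has_derivative (\<lambda>h. \<alpha> * h + \<beta> * cnj h)) (at z)"
    using assms(1) by (auto simp: dilatation_le_at_def)
  have "((\<lambda>w. \<phi> (g w)) has_derivative (\<lambda>h. d * (\<alpha> * h + \<beta> * cnj h))) (at z)"
    using has_derivative_compose[OF ab(2)] assms(2) by (auto simp: has_field_derivative_def)
  moreover have "cmod (d * \<beta>) \<le> k * cmod (d * \<alpha>)"
    using mult_left_mono[OF ab(1), of "cmod d"] by (simp add: norm_mult mult_ac)
  ultimately show ?thesis
    unfolding dilatation_le_at_def by (intro exI[of _ "d * \<alpha>"] exI[of _ "d * \<beta>"]) (simp add: algebra_simps)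
qed

lemma dilatation_le_at_compose_field:
  assumes "(\<mu> has_field_derivative d) (at z)" and "dilatation_le_at k g (\<mu> z)"
  shows "dilatation_le_at k (\<lambda>w. g (\<mu> w)) z"
proof -
  obtain \<alpha> \<beta> where ab: "cmod \<beta> \<le> k * cmod \<alpha>" "(g has_derivative (\<lambda>h. \<alpha> * h + \<beta> * cnj h)) (at (\<mu> z))"
    using assms(2) by (auto simp: dilatation_le_at_def)
  have "((\<lambda>w. g (\<mu> w)) has_derivative (\<lambda>h. \<alpha> * (d * h) + \<beta> * cnj (d * h))) (at z)"
    by (rule has_derivative_compose[where f = \<mu> and f' = "\<lambda>h. d * h"
          and g = g and g' = "\<lambda>h. \<alpha> * h + \<beta> * cnj h"])
      (use assms(1) ab(2) in \<open>auto simp: has_field_derivative_def\<close>)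
  moreover have "cmod (\<beta> * cnj d) \<le> k * cmod (\<alpha> * d)"
    using mult_right_mono[OF ab(1), of "cmod d"] by (simp add: norm_mult mult_ac)
  ultimately show ?thesis
    unfolding dilatation_le_at_def by (intro exI[of _ "\<alpha> * d"] exI[of _ "\<beta> * cnj d"]) (simp add: algebra_simps)
qed

lemma dilatation_le_at_holomorphic:
  assumes "0 \<le> k" and "f holomorphic_on S" and "open S" and "z \<in> S"
  shows "dilatation_le_at k f z"
proof -
  have "(f has_field_derivative deriv f z) (at z)"
    using assms by (simp add: holomorphic_derivI)
  then show ?thesis
    using assms(1) unfolding dilatation_le_at_def has_field_derivative_def
    by (intro exI[of _ "deriv f z"] exI[of _ 0]) auto
qed

text \<open>The partial derivatives are \<open>\<alpha> + \<beta>\<close> and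
  \<open>\<i> * (\<alpha> - \<beta>)\<close>, from which \<open>wirtinger_z\<close> and
  \<open>wirtinger_zbar\<close> recover \<open>\<alpha>\<close> and \<open>\<beta>\<close>.
  Measurability comes from the difference quotients, not from the pointwise choice of
  \<open>\<alpha>\<close> and \<open>\<beta>\<close>.\<close>

lemma W12_loc_and_dilatation:
  assumes "open \<Omega>" and "closed N" and "N \<in> null_sets lborel"
    and "\<And>z. z \<in> \<Omega> \<Longrightarrow> lip_at g z" and "\<And>z. z \<in> \<Omega> - N \<Longrightarrow> dilatation_le_at k g z"
  shows "\<exists>gx gy. W12_loc \<Omega> g gx gy \<and>
        (AE z in lborel. z \<in> \<Omega> \<longrightarrow>
           cmod (wirtinger_zbar (gx z) (gy z)) \<le> k * cmod (wirtinger_z (gx z) (gy z)))"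
proof -
  have "\<forall>z. \<exists>p. z \<in> \<Omega> - N \<longrightarrow> cmod (snd p) \<le> k * cmod (fst p) \<and>
      (g has_derivative (\<lambda>h. fst p * h + snd p * cnj h)) (at z)"
    using assms(5) unfolding dilatation_le_at_def by simp
  from choice[OF this] obtain p where p: "\<forall>z. z \<in> \<Omega> - N \<longrightarrow> cmod (snd (p z)) \<le> k * cmod (fst (p z)) \<and>
      (g has_derivative (\<lambda>h. fst (p z) * h + snd (p z) * cnj h)) (at z)" by blast
  define \<alpha> \<beta> where "\<alpha> = (\<lambda>z. fst (p z))" and "\<beta> = (\<lambda>z. snd (p z))"
  from p have ab: "\<And>z. z \<in> \<Omega> - N \<Longrightarrow> cmod (\<beta> z) \<le> k * cmod (\<alpha> z)"
    "\<And>z. z \<in> \<Omega> - N \<Longrightarrow> (g has_derivative (\<lambda>h. \<alpha> z * h + \<beta> z * cnj h)) (at z)"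
    unfolding \<alpha>_def \<beta>_def by blast+
  define D where "D = (\<lambda>z h. \<alpha> z * h + \<beta> z * cnj h)"
  define d where "d = piecewise_derivative \<Omega> N D"
  have "W12_loc \<Omega> g (d 1) (d \<i>)"
    unfolding d_def using assms ab(2) by (intro W12_loc_pw) (auto simp: D_def)
  moreover have "AE z in lborel. z \<notin> N" using assms(3) by (rule AE_not_in)
  then have "AE z in lborel. z \<in> \<Omega> \<longrightarrow>
           cmod (wirtinger_zbar (d 1 z) (d \<i> z)) \<le> k * cmod (wirtinger_z (d 1 z) (d \<i> z))"
  proof eventually_elim
    fix z assume "z \<notin> N"
    then show "z \<in> \<Omega> \<longrightarrow> cmod (wirtinger_zbar (d 1 z) (d \<i> z)) \<le> k * cmod (wirtinger_z (d 1 z) (d \<i> z))"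
      using ab(1)[of z]
      by (auto simp: d_def piecewise_derivative_def D_def wirtinger_zbar_def wirtinger_z_def algebra_simps)
  qed
  ultimately show ?thesis by blast
qed

section \<open>Winding numbers of nearly linear maps\<close>

text \<open>The integrand is the constant \<open>2 * pi * \<i>\<close>. This loop is the linear
  model with which the images of small circles are compared.\<close>

lemma winding_number_scaled_circle:
  assumes "r > 0" and "c \<noteq> 0"
  shows "valid_path (\<lambda>t. w + c * (circlepath z r t - z))"
    and "winding_number (\<lambda>t. w + c * (circlepath z r t - z)) w = 1"
proof -
  let ?\<gamma> = "\<lambda>t. w + c * (circlepath z r t - z)"
  have eq: "?\<gamma> = (\<lambda>t. w + c * (of_real r * exp (2 * of_real pi * \<i> * of_real t)))"
    by (simp add: circlepath fun_eq_iff)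
  have der: "(?\<gamma> has_vector_derivative (2 * of_real pi * \<i> * (c * (of_real r * exp (2 * of_real pi * \<i> * of_real t))))) (at t)" for t
    unfolding eq
    by (rule has_vector_derivative_real_field) (auto intro!: derivative_eq_intros)
  show v: "valid_path ?\<gamma>"
    unfolding valid_path_def
  proof (rule C1_differentiable_imp_piecewise)
    show "?\<gamma> C1_differentiable_on {0..1}"
      unfolding C1_differentiable_on_def
      by (intro exI[of _ "\<lambda>t. 2 * of_real pi * \<i> * (c * (of_real r * exp (2 * of_real pi * \<i> * of_real t)))"])
         (use der in \<open>auto intro!: continuous_intros\<close>)
  qed
  have "w \<notin> path_image ?\<gamma>"
    using assms by (auto simp: path_image_def eq)
  then have "winding_number ?\<gamma> w = 1 / (2 * pi * \<i>) * contour_integral ?\<gamma> (\<lambda>z. 1 / (z - w))"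
    by (rule winding_number_valid_path[OF v])
  also have "contour_integral ?\<gamma> (\<lambda>z. 1 / (z - w)) = integral {0..1} (\<lambda>t::real. 2 * of_real pi * \<i>)"
    unfolding contour_integral_integral vector_derivative_at[OF der]
    by (intro integral_cong) (use assms in \<open>auto simp: circlepath\<close>)
  finally show "winding_number ?\<gamma> w = 1" by simp
qed

text \<open>Near \<open>z\<close> the difference quotients lie in a disc around \<open>c\<close>
  that avoids 0. No derivative has to exist, so the notion also covers points of the unit
  circle.\<close>

definition nearly_linear :: "(complex \<Rightarrow> complex) \<Rightarrow> complex \<Rightarrow> bool" where
  "nearly_linear g z \<longleftrightarrow> (\<exists>c k. c \<noteq> 0 \<and> k < 1 \<and>
     (\<forall>\<^sub>F w in at z. cmod ((g w - g z) / (w - z) - c) \<le> k * cmod c))"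

text \<open>On a small circle the image loop differs from the linear model \<open>h\<close> by less
  than the distance of \<open>h\<close> from \<open>g z\<close>, so both have the same winding
  number about \<open>g z\<close>. Local Lipschitz continuity makes the image loop a path.\<close>

lemma winding_number_nearly_linear:
  assumes "lip_at g z" and "nearly_linear g z"
  shows "\<forall>\<^sub>F r in at_right 0. winding_number (g \<circ> circlepath z r) (g z) = 1"
proof -
  obtain c k where c: "c \<noteq> 0" "k < 1"
      "\<forall>\<^sub>F w in at z. cmod ((g w - g z) / (w - z) - c) \<le> k * cmod c"
    using assms(2) unfolding nearly_linear_def by blast
  obtain d where d: "d > 0" "\<And>w. w \<noteq> z \<Longrightarrow> dist w z < d \<Longrightarrow> cmod ((g w - g z) / (w - z) - c) \<le> k * cmod c"
    using c(3) by (auto simp: eventually_at)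
  obtain e where e: "e > 0" "\<And>w. dist w z < e \<Longrightarrow> isCont g w"
    using lip_at_continuous[OF assms(1)] by (auto simp: eventually_nhds_metric)
  have "winding_number (g \<circ> circlepath z r) (g z) = 1" if r: "0 < r" "r < min d e" for r
  proof -
    define h where "h = (\<lambda>t. g z + c * (circlepath z r t - z))"
    have dc: "dist (circlepath z r t) z = r" for t
      using r by (simp add: circlepath dist_norm norm_mult)
    have "continuous_on (sphere z r) g"
      using e(2) r by (intro continuous_at_imp_continuous_on) (auto simp: dist_commute)
    then have pg: "path (g \<circ> circlepath z r)"
      using r by (intro path_continuous_image) auto
    have "winding_number (g \<circ> circlepath z r) (g z) = winding_number h (g z)"
    proof (rule winding_number_nearby_loops_eq)
      show "path h" unfolding h_def
        by (rule valid_path_imp_path[OF winding_number_scaled_circle(1)[OF r(1) c(1)]])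
      fix t :: real
      let ?w = "circlepath z r t"
      have wz: "?w \<noteq> z" using dc[of t] r by auto
      have "cmod ((g ?w - g z) / (?w - z) - c) * cmod (?w - z) < cmod c * cmod (?w - z)"
      proof (rule mult_strict_right_mono)
        have "cmod ((g ?w - g z) / (?w - z) - c) \<le> k * cmod c"
          using dc[of t] r wz by (intro d(2)) auto
        also have "\<dots> < 1 * cmod c" using c by (intro mult_strict_right_mono) auto
        finally show "cmod ((g ?w - g z) / (?w - z) - c) < cmod c" by simp
      qed (use wz in auto)
      also have "cmod ((g ?w - g z) / (?w - z) - c) * cmod (?w - z) = cmod ((g \<circ> circlepath z r) t - h t)"
      proof -
        have "(g ?w - g z) / (?w - z) * (?w - z) = g ?w - g z"
          using wz by simp
        then have "((g ?w - g z) / (?w - z) - c) * (?w - z) = (g \<circ> circlepath z r) t - h t"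
          by (simp only: h_def left_diff_distrib o_apply diff_diff_eq)
        then show ?thesis by (metis norm_mult)
      qed
      also have "cmod c * cmod (?w - z) = cmod (h t - g z)"
        by (simp add: h_def norm_mult)
      finally show "cmod ((g \<circ> circlepath z r) t - h t) < cmod (h t - g z)" .
    qed (use pg in \<open>auto simp: h_def pathfinish_def pathstart_def circlepath\<close>)
    also have "\<dots> = 1"
      unfolding h_def by (rule winding_number_scaled_circle(2)[OF r(1) c(1)])
    finally show ?thesis .
  qed
  then show ?thesis
    unfolding eventually_at_right_field using d(1) e(1) by (intro exI[of _ "min d e"]) auto
qed

lemma nearly_linear_cong:
  assumes "\<forall>\<^sub>F w in nhds z. f w = g w" and "nearly_linear g z"
  shows "nearly_linear f z"
proof -
  obtain c k where c: "c \<noteq> 0" "k < 1"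
      "\<forall>\<^sub>F w in at z. cmod ((g w - g z) / (w - z) - c) \<le> k * cmod c"
    using assms(2) unfolding nearly_linear_def by blast
  have "\<forall>\<^sub>F w in at z. f w = g w" and fz: "f z = g z"
    using assms(1) by (auto simp: eventually_nhds_conv_at)
  from this(1) c(3) have "\<forall>\<^sub>F w in at z. cmod ((f w - f z) / (w - z) - c) \<le> k * cmod c"
    by eventually_elim (simp add: fz)
  with c show ?thesis unfolding nearly_linear_def by blast
qed

lemma nearly_linear_of_derivative:
  assumes "(g has_derivative (\<lambda>h. \<alpha> * h + \<beta> * cnj h)) (at z)" and "cmod \<beta> < cmod \<alpha>"
  shows "nearly_linear g z"
proof -
  \<comment> \<open>Half of the gap between the two moduli is granted to the remainder term, which
    leaves \<open>cmod \<beta> + e\<close> below \<open>cmod \<alpha>\<close>.\<close>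
  define e where "e = (cmod \<alpha> - cmod \<beta>) / 2"
  have e: "e > 0" using assms(2) by (simp add: e_def)
  have a: "\<alpha> \<noteq> 0" using assms(2) by auto
  define k where "k = (cmod \<beta> + e) / cmod \<alpha>"
  have k: "k < 1" using assms(2) a by (simp add: k_def e_def field_simps)
  have "((\<lambda>w. norm (g w - g z - (\<alpha> * (w - z) + \<beta> * cnj (w - z))) / norm (w - z)) \<longlongrightarrow> 0) (at z)"
    using assms(1) by (simp add: has_derivative_iff_norm)
  then have "\<forall>\<^sub>F w in at z. norm (g w - g z - (\<alpha> * (w - z) + \<beta> * cnj (w - z))) / norm (w - z) < e"
    using e by (rule order_tendstoD)
  moreover have "\<forall>\<^sub>F w in at z. w \<noteq> z" by (simp add: eventually_at_filter)
  ultimately have "\<forall>\<^sub>F w in at z. cmod ((g w - g z) / (w - z) - \<alpha>) \<le> k * cmod \<alpha>"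
  proof eventually_elim
    fix w assume w: "norm (g w - g z - (\<alpha> * (w - z) + \<beta> * cnj (w - z))) / norm (w - z) < e" "w \<noteq> z"
    have "(g w - g z) / (w - z) - \<alpha> = (g w - g z - (\<alpha> * (w - z) + \<beta> * cnj (w - z))) / (w - z) + \<beta> * cnj (w - z) / (w - z)"
      using w(2) by (simp add: diff_divide_distrib add_divide_distrib del: complex_cnj_diff)
    also have "cmod \<dots> \<le> cmod (g w - g z - (\<alpha> * (w - z) + \<beta> * cnj (w - z))) / cmod (w - z) + cmod \<beta> * cmod (cnj (w - z)) / cmod (w - z)"
      by (metis norm_divide norm_mult norm_triangle_ineq)
    also have "\<dots> \<le> e + cmod \<beta>"
      using w by (simp add: complex_mod_cnj del: complex_cnj_diff)
    finally show "cmod ((g w - g z) / (w - z) - \<alpha>) \<le> k * cmod \<alpha>"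
      using a by (simp add: k_def add.commute)
  qed
  then show ?thesis unfolding nearly_linear_def using a k by blast
qed

lemma nearly_linear_deriv:
  assumes "(g has_field_derivative d) (at z)" and "d \<noteq> 0"
  shows "nearly_linear g z"
  using assms by (intro nearly_linear_of_derivative[of g d 0]) (auto simp: has_field_derivative_def)

lemma sense_preservingI:
  assumes "\<And>z. z \<in> chart_dom id id F \<Longrightarrow> lip_at (chart_rep id id F) z"
    and "\<And>z. z \<in> chart_dom id id F \<Longrightarrow> nearly_linear (chart_rep id id F) z"
  shows "sense_preserving F"
  unfolding sense_preserving_def
  by (intro ballI winding_number_nearly_linear assms)

section \<open>Homeomorphisms of the sphere\<close>

fun fix_infinity :: "(complex \<Rightarrow> complex) \<Rightarrow> riemann_sphere \<Rightarrow> riemann_sphere" where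
  "fix_infinity H None = None"
| "fix_infinity H (Some z) = Some (H z)"

text \<open>Neighbourhoods of infinity pull back to such neighbourhoods because the complement of
  the preimage is the image of a compact set under the continuous inverse \<open>K\<close>.\<close>

lemma continuous_map_fix_infinity:
  assumes "homeomorphism UNIV UNIV H K"
  shows "continuous_map sphere_topology sphere_topology (fix_infinity H)"
  unfolding continuous_map topspace_sphere_topology openin_sphere_topology
proof (intro conjI allI impI)
  have H: "continuous_on UNIV H" and K: "continuous_on UNIV K" and HK: "\<And>z. K (H z) = z" "\<And>z. H (K z) = z"
    using assms by (auto simp: homeomorphism_def)
  fix U assume U: "sphere_open U"
  have "open (H -` {z. Some z \<in> U})"
    using U H by (intro open_vimage) (auto simp: sphere_open_def)
  moreover have "compact (K ` {z. Some z \<notin> U})" if "None \<in> U"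
    using U K that by (intro compact_continuous_image) (auto simp: sphere_open_def intro: continuous_on_subset)
  moreover have "K ` {z. Some z \<notin> U} = {z. Some (H z) \<notin> U}"
  proof (intro equalityI subsetI)
    fix w assume "w \<in> {z. Some (H z) \<notin> U}"
    then have "w = K (H w)" "H w \<in> {z. Some z \<notin> U}" using HK by auto
    then show "w \<in> K ` {z. Some z \<notin> U}" by (rule image_eqI)
  qed (use HK in auto)
  ultimately show "sphere_open {x \<in> UNIV. fix_infinity H x \<in> U}"
    by (auto simp: sphere_open_def vimage_def)
qed auto

lemma homeomorphic_map_fix_infinity:
  assumes "homeomorphism UNIV UNIV H K"
  shows "homeomorphic_map sphere_topology sphere_topology (fix_infinity H)"
proof -
  have "homeomorphic_maps sphere_topology sphere_topology (fix_infinity H) (fix_infinity K)"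
    unfolding homeomorphic_maps_def
  proof (intro conjI ballI)
    show "continuous_map sphere_topology sphere_topology (fix_infinity H)"
      using assms by (rule continuous_map_fix_infinity)
    show "continuous_map sphere_topology sphere_topology (fix_infinity K)"
      by (rule continuous_map_fix_infinity[where K = H]) (rule homeomorphism_symD[OF assms])
    show "fix_infinity K (fix_infinity H x) = x" for x
      using assms by (cases x) (auto simp: homeomorphism_def)
    show "fix_infinity H (fix_infinity K x) = x" for x
      using assms by (cases x) (auto simp: homeomorphism_def)
  qed
  then show ?thesis by (rule homeomorphic_maps_imp_map)
qed

lemma sphere_inv_sphere_inv [simp]: "sphere_inv (sphere_inv x) = x"
  by (cases x) (auto simp: sphere_div_def)

text \<open>Away from 0 and infinity this is continuity of \<open>1/z\<close>. At 0, a bound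
  \<open>B\<close> on the complement of \<open>U\<close> yields the disc of radius
  \<open>1/B\<close>; at infinity, a disc of radius \<open>e\<close> around 0 inside
  \<open>U\<close> yields the bound \<open>1/e\<close>.\<close>

lemma continuous_map_sphere_inv: "continuous_map sphere_topology sphere_topology sphere_inv"
  unfolding continuous_map topspace_sphere_topology openin_sphere_topology
proof (intro conjI allI impI)
  fix U assume U: "sphere_open U"
  define V where "V = {z. Some z \<in> U}"
  have V: "open V" using U by (simp add: sphere_open_def V_def)
  define V' where "V' = {z. sphere_inv (Some z) \<in> U}"
  have open': "open V'"
    unfolding open_contains_ball
  proof
    fix z assume z: "z \<in> V'"
    show "\<exists>e>0. ball z e \<subseteq> V'"
    proof (cases "z = 0")
      case False
      have "open (- {0} \<inter> (\<lambda>z. 1 / z) -` V)"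
        using V by (intro continuous_open_preimage) (auto intro!: continuous_intros)
      moreover have "z \<in> - {0} \<inter> (\<lambda>z. 1 / z) -` V"
        using z False by (auto simp: V'_def V_def sphere_div_def)
      ultimately obtain e where "e > 0" "ball z e \<subseteq> - {0} \<inter> (\<lambda>z. 1 / z) -` V"
        using open_contains_ball by blast
      moreover have "- {0} \<inter> (\<lambda>z. 1 / z) -` V \<subseteq> V'"
        by (auto simp: V'_def V_def sphere_div_def)
      ultimately show ?thesis by blast
    next
      case True
      then have "None \<in> U" using z by (simp add: V'_def sphere_div_def)
      then have "compact (- V)" using U by (auto simp: sphere_open_def V_def Compl_eq)
      then obtain B where B: "B > 0" "\<And>w. w \<notin> V \<Longrightarrow> cmod w \<le> B"
        using compact_imp_bounded[of "- V"] by (auto simp: bounded_pos)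
      have "w \<in> V'" if "w \<in> ball 0 (1/B)" for w
      proof (cases "w = 0")
        case False
        then have "cmod (1 / w) > B" using that B(1) by (simp add: norm_divide field_simps)
        then have "1 / w \<in> V" using B(2) by (meson not_le)
        then show ?thesis using False by (simp add: V'_def V_def sphere_div_def)
      qed (use True z in simp)
      then show ?thesis using B(1) True by (intro exI[of _ "1/B"]) auto
    qed
  qed
  \<comment> \<open>Infinity belongs to the preimage exactly when \<open>Some 0\<close> belongs to
    \<open>U\<close>.\<close>
  have "compact (- V')" if "Some 0 \<in> U"
  proof -
    have "0 \<in> V" using that by (simp add: V_def)
    then obtain e where e: "e > 0" "ball 0 e \<subseteq> V" using V open_contains_ball by blast
    have "cmod z \<le> 1 / e" if "z \<notin> V'" for z
    proof (rule ccontr)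
      assume *: "\<not> cmod z \<le> 1 / e"
      then have "z \<noteq> 0" using e(1) by auto
      moreover from * e(1) \<open>z \<noteq> 0\<close> have "1 / z \<in> ball 0 e" by (simp add: norm_divide field_simps)
      ultimately show False using that e(2) by (auto simp: V'_def V_def sphere_div_def)
    qed
    then have "bounded (- V')" by (auto simp: bounded_iff)
    then show ?thesis using open' by (simp add: compact_eq_bounded_closed closed_def)
  qed
  with open' show "sphere_open {x \<in> UNIV. sphere_inv x \<in> U}"
    by (auto simp: sphere_open_def V'_def Compl_eq)
qed auto

lemma homeomorphic_map_sphere_inv: "homeomorphic_map sphere_topology sphere_topology sphere_inv"
  by (rule homeomorphic_maps_imp_map[of _ _ _ sphere_inv])
     (auto simp: homeomorphic_maps_def continuous_map_sphere_inv)

section \<open>Sobolev regularity and dilatation in all pairs of coordinates\<close>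

definition charts_dilatation :: "real \<Rightarrow> (riemann_sphere \<Rightarrow> riemann_sphere) \<Rightarrow> bool" where
  "charts_dilatation k F \<longleftrightarrow> (\<forall>a\<in>{id, sphere_inv}. \<forall>b\<in>{id, sphere_inv}. \<exists>gx gy.
        W12_loc (chart_dom a b F) (chart_rep a b F) gx gy \<and>
        (AE z in lborel. z \<in> chart_dom a b F \<longrightarrow>
           cmod (wirtinger_zbar (gx z) (gy z)) \<le> k * cmod (wirtinger_z (gx z) (gy z))))"

text \<open>The inversion is an involution, so conjugation with it only permutes the four pairs of
  coordinates.\<close>

lemma charts_dilatation_sphere_inv:
  assumes "charts_dilatation k F"
  shows "charts_dilatation k (sphere_inv \<circ> F \<circ> sphere_inv)"
proof -
  have inv2: "sphere_inv \<circ> sphere_inv = id" by (auto simp: fun_eq_iff)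
  have "chart_dom a b (sphere_inv \<circ> F \<circ> sphere_inv) = chart_dom (sphere_inv \<circ> a) (b \<circ> sphere_inv) F"
    "chart_rep a b (sphere_inv \<circ> F \<circ> sphere_inv) = chart_rep (sphere_inv \<circ> a) (b \<circ> sphere_inv) F" for a b
    by (auto simp: chart_dom_def chart_rep_def fun_eq_iff)
  then show ?thesis
    using assms inv2 unfolding charts_dilatation_def by auto
qed

text \<open>On the circle the two formulas of an extension meet; the origin is the point that
  \<open>1/w\<close> takes to infinity. The complement of their union is stable under
  \<open>w \<mapsto> 1/w\<close>, so one exceptional set serves all coordinates.\<close>

lemma circle_and_origin_null: "sphere 0 1 \<union> {0::complex} \<in> null_sets lborel"
proof -
  have "negligible (sphere 0 1 \<union> {0::complex})"
    by (intro negligible_Un negligible_sphere negligible_sing)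
  then show ?thesis
    by (subst null_sets_completion_iff[symmetric]) (auto simp: negligible_iff_null_sets)
qed

text \<open>A change of coordinates composes \<open>H\<close> with \<open>1/w\<close> on one side or
  both, which preserves the local properties wherever \<open>1/w\<close> is regular. Only the origin
  of the coordinate at infinity escapes this argument; \<open>lip0\<close> and \<open>H0\<close>
  take care of it.\<close>

lemma charts_dilatation_fix_infinity:
  assumes k: "0 \<le> k" and lip: "\<And>z. lip_at H z"
    and lip0: "lip_at (\<lambda>w. if w = 0 then 0 else 1 / H (1 / w)) 0"
    and kd: "\<And>z. z \<notin> sphere 0 1 \<union> {0} \<Longrightarrow> dilatation_le_at k H z"
    and H0: "\<forall>\<^sub>F w in at 0. H (1 / w) \<noteq> 0"
  shows "charts_dilatation k (fix_infinity H)"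
  unfolding charts_dilatation_def
proof (intro ballI)
  define N where "N = sphere 0 1 \<union> {0::complex}"
  have N: "closed N" "N \<in> null_sets lborel"
    by (simp add: N_def closed_Un) (use circle_and_origin_null in \<open>simp add: N_def\<close>)
  have Ninv: "1 / z \<notin> N" if "z \<notin> N" for z
    using that by (auto simp: N_def norm_divide)
  have cH: "continuous_on UNIV H" using lip by (intro lip_at_continuous_on) auto
  have der_inv: "((\<lambda>w. 1 / w) has_field_derivative - (1 / z\<^sup>2)) (at z)" if "z \<noteq> 0" for z :: complex
    using that by (auto intro!: derivative_eq_intros simp: power2_eq_square)
  fix a b :: "riemann_sphere \<Rightarrow> riemann_sphere"
  assume a: "a \<in> {id, sphere_inv}" and b: "b \<in> {id, sphere_inv}"
  let ?D = "chart_dom a b (fix_infinity H)" and ?R = "chart_rep a b (fix_infinity H)"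
  have main: "open ?D \<and> (\<forall>z\<in>?D. lip_at ?R z) \<and> (\<forall>z\<in>?D - N. dilatation_le_at k ?R z)"
  proof -
    consider "a = id" "b = id" | "a = id" "b = sphere_inv" | "a = sphere_inv" "b = id" | "a = sphere_inv" "b = sphere_inv"
      using a b by blast
    then show ?thesis
    proof cases
      case 1
      have D: "?D = UNIV" and R: "?R = H" by (auto simp: 1 chart_dom_def chart_rep_def fun_eq_iff)
      show ?thesis unfolding D R using lip kd by (auto simp: N_def)
    next
      case 2
      have D: "?D = {z. H z \<noteq> 0}" by (auto simp: 2 chart_dom_def sphere_div_def)
      have op: "open {z. H z \<noteq> 0}"
        by (intro open_Collect_neq cH continuous_intros)
      have R: "\<forall>\<^sub>F w in nhds z. ?R w = 1 / H w" if "z \<in> {z. H z \<noteq> 0}" for z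
        using eventually_nhds_in_open[OF op that]
        by eventually_elim (auto simp: 2 chart_rep_def sphere_div_def)
      show ?thesis unfolding D
      proof (intro conjI op ballI)
        fix z assume z: "z \<in> {z. H z \<noteq> 0}"
        show "lip_at ?R z"
          by (rule lip_at_cong[OF R[OF z]], rule lip_at_compose[OF lip lip_at_inverse]) (use z in auto)
      next
        fix z assume z: "z \<in> {z. H z \<noteq> 0} - N"
        show "dilatation_le_at k ?R z"
          by (rule dilatation_le_at_cong[OF R], use z in simp, rule dilatation_le_at_field_compose[OF _ der_inv])
             (use z kd in \<open>auto simp: N_def\<close>)
      qed
    next
      case 3
      \<comment> \<open>The origin stands for infinity, which goes to infinity and so has no finite
        value.\<close>
      have D: "?D = - {0}" by (auto simp: 3 chart_dom_def sphere_div_def)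
      have R: "\<forall>\<^sub>F w in nhds z. ?R w = H (1 / w)" if "z \<in> - {0}" for z
        using eventually_nhds_in_open[OF open_Compl[OF closed_singleton] that]
        by eventually_elim (auto simp: 3 chart_rep_def sphere_div_def)
      show ?thesis unfolding D
      proof (intro conjI ballI)
        fix z :: complex assume z: "z \<in> - {0}"
        show "lip_at ?R z"
          by (rule lip_at_cong[OF R[OF z]], rule lip_at_compose[OF lip_at_inverse lip]) (use z in auto)
      next
        fix z :: complex assume z: "z \<in> - {0} - N"
        show "dilatation_le_at k ?R z"
          by (rule dilatation_le_at_cong[OF R], use z in simp, rule dilatation_le_at_compose_field[OF der_inv])
             (use z kd Ninv in \<open>auto simp: N_def\<close>)
      qed auto
    next
      case 4
      define J where "J = (\<lambda>w. if w = 0 then 0 else 1 / H (1 / w))"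
      have D: "?D = insert 0 {w. w \<noteq> 0 \<and> H (1 / w) \<noteq> 0}" (is "_ = insert 0 ?E")
        by (auto simp: 4 chart_dom_def sphere_div_def)
      have opE: "open ?E"
      proof -
        have "continuous_on (- {0}) (\<lambda>w. H (1 / w))"
          by (intro continuous_on_compose2[OF cH] continuous_intros) auto
        from continuous_open_preimage[OF this, of "- {0}"] have "open (- {0} \<inter> (\<lambda>w. H (1 / w)) -` (- {0}))" by auto
        also have "- {0} \<inter> (\<lambda>w. H (1 / w)) -` (- {0}) = ?E" by auto
        finally show ?thesis .
      qed
      \<comment> \<open>\<open>H0\<close> makes the origin an interior point of the domain of the
        chart expression.\<close>
      have "\<forall>\<^sub>F w in nhds 0. w \<in> insert 0 ?E"
        using H0 by (auto simp: eventually_at_filter elim!: eventually_mono)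
      then obtain S where S: "open S" "0 \<in> S" "S \<subseteq> insert 0 ?E"
        by (auto simp: eventually_nhds)
      have "open (S \<union> ?E)" using S opE by blast
      also have "S \<union> ?E = insert 0 ?E" using S by blast
      finally have op: "open (insert 0 ?E)" .
      have R: "\<forall>\<^sub>F w in nhds z. ?R w = J w" if "z \<in> insert 0 ?E" for z
        using eventually_nhds_in_open[OF op that]
        by eventually_elim (auto simp: 4 chart_rep_def sphere_div_def J_def)
      have J: "\<forall>\<^sub>F w in nhds z. J w = 1 / H (1 / w)" if "z \<in> ?E" for z
        using eventually_nhds_in_open[OF opE that]
        by eventually_elim (auto simp: J_def)
      show ?thesis unfolding D
      proof (intro conjI op ballI)
        fix z assume z: "z \<in> insert 0 ?E"
        have "lip_at J z"
        proof (cases "z = 0")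
          case False
          then have E: "z \<in> ?E" using z by simp
          show ?thesis
            by (rule lip_at_cong[OF J[OF E]], rule lip_at_compose[OF lip_at_compose[OF lip_at_inverse lip] lip_at_inverse])
               (use E in auto)
        qed (use lip0 in \<open>simp add: J_def\<close>)
        then show "lip_at ?R z" by (rule lip_at_cong[OF R[OF z]])
      next
        fix z assume z: "z \<in> insert 0 ?E - N"
        then have E: "z \<in> ?E" by (auto simp: N_def)
        have "dilatation_le_at k J z"
          by (rule dilatation_le_at_cong[OF J[OF E]], rule dilatation_le_at_field_compose[OF dilatation_le_at_compose_field[OF der_inv] der_inv])
             (use z E kd Ninv in \<open>auto simp: N_def\<close>)
        then show "dilatation_le_at k ?R z" by (intro dilatation_le_at_cong[OF R]) (use z in auto)
      qed
    qed
  qed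
  then show "\<exists>gx gy. W12_loc ?D ?R gx gy \<and>
        (AE z in lborel. z \<in> ?D \<longrightarrow>
           cmod (wirtinger_zbar (gx z) (gy z)) \<le> k * cmod (wirtinger_z (gx z) (gy z)))"
    using N by (intro W12_loc_and_dilatation) auto
qed

section \<open>The reflected extension\<close>

lemma class_U_recip_quot:
  assumes lam: "lam \<le> 1" and f: "f \<in> class_U lam"
    and a: "\<And>z. z \<in> ball 0 1 \<Longrightarrow> (\<lambda>n. a (n + 2) * z ^ (n + 2)) sums (f z - z)"
  obtains p where "p holomorphic_on ball 0 1" and "p 0 = 0"
    and "\<And>z. z \<in> ball 0 1 \<Longrightarrow> recip_quot f z = 1 - a 2 * z + z * p z"
    and "\<And>z. z \<in> ball 0 1 \<Longrightarrow> recip_quot f z \<noteq> 0"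
    and "\<And>z. z \<in> ball 0 1 \<Longrightarrow> f z = z / recip_quot f z"
    and "\<And>z. z \<in> ball 0 1 \<Longrightarrow> U_op f z = - (z\<^sup>2 * deriv p z)"
proof -
  have A: "f holomorphic_on ball 0 1" "f 0 = 0" "deriv f 0 = 1"
    and U: "\<And>z. z \<in> ball 0 1 \<Longrightarrow> cmod (U_op f z) < lam"
    using f by (auto simp: class_U_def class_A_def)
  \<comment> \<open>At a zero of \<open>f\<close> other than 0, division by 0 would make
    \<open>U_op f\<close> equal to -1, against \<open>cmod (U_op f z) < lam\<close> and
    \<open>lam \<le> 1\<close>.\<close>
  have f0: "f z \<noteq> 0" if "z \<in> ball 0 1" "z \<noteq> 0" for z
    using U[OF that(1)] that lam by (auto simp: U_op_def recip_quot_def)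
  \<comment> \<open>The power series exhibits the singularity of \<open>(f z - z) / z^2\<close> at 0
    as removable, with value \<open>a 2\<close>.\<close>
  define s where "s = (\<lambda>z. if z = 0 then a 2 else (f z - z) / z\<^sup>2)"
  have "(\<lambda>n. a (n + 2) * (z - 0) ^ n) sums s z" if "z \<in> ball 0 1" for z
  proof (cases "z = 0")
    case True
    then show ?thesis using powser_sums_zero[of "\<lambda>n. a (n + 2)"] by (simp add: s_def numeral_2_eq_2)
  next
    case False
    have "(\<lambda>n. a (n + 2) * z ^ (n + 2) / z\<^sup>2) sums ((f z - z) / z\<^sup>2)"
      using a[OF that] by (rule sums_divide)
    also have "(\<lambda>n. a (n + 2) * z ^ (n + 2) / z\<^sup>2) = (\<lambda>n. a (n + 2) * z ^ n)"
      using False by (simp only: power_add) simp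
    finally show ?thesis using False by (simp add: s_def)
  qed
  then have hs: "s holomorphic_on ball 0 1" by (rule power_series_holomorphic)
  have fs: "f z = z * (1 + z * s z)" if "z \<in> ball 0 1" for z
    using A(2) by (cases "z = 0") (auto simp: s_def power2_eq_square field_simps)
  have e0: "1 + z * s z \<noteq> 0" if "z \<in> ball 0 1" for z
    using f0[OF that] fs[OF that] by (cases "z = 0") auto
  \<comment> \<open>The solution of \<open>1 - a 2 * z + z * p z = 1 / (1 + z * s z)\<close>, with
    the factor \<open>z\<close> already cancelled and hence regular at 0.\<close>
  define p where "p = (\<lambda>z. (a 2 - s z + a 2 * z * s z) / (1 + z * s z))"
  have hp: "p holomorphic_on ball 0 1"
    unfolding p_def using e0 by (intro holomorphic_intros hs) auto
  have q: "recip_quot f z = 1 / (1 + z * s z)" if "z \<in> ball 0 1" for z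
    using fs[OF that] by (simp add: recip_quot_def)
  have qp: "recip_quot f z = 1 - a 2 * z + z * p z" if "z \<in> ball 0 1" for z
    using e0[OF that] unfolding q[OF that] p_def by (simp add: divide_simps) (simp add: algebra_simps)
  have q0: "recip_quot f z \<noteq> 0" if "z \<in> ball 0 1" for z
    using e0[OF that] q[OF that] by simp
  have fq: "f z = z / recip_quot f z" if "z \<in> ball 0 1" for z
    using A(2) f0[OF that] by (auto simp: recip_quot_def)
  have "U_op f z = - (z\<^sup>2 * deriv p z)" if z: "z \<in> ball 0 1" for z
  proof (cases "z = 0")
    case True
    then show ?thesis using A(3) by (simp add: U_op_def recip_quot_def)
  next
    case False
    define q where "q = (\<lambda>w. 1 - a 2 * w + w * p w)"
    have dp: "(p has_field_derivative deriv p z) (at z)"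
      using hp z by (simp add: holomorphic_derivI)
    have qz: "q z \<noteq> 0" using q0[OF z] qp[OF z] by (simp add: q_def)
    have dq: "(q has_field_derivative (- a 2 + p z + z * deriv p z)) (at z)"
      unfolding q_def by (auto intro!: derivative_eq_intros dp)
    \<comment> \<open>From \<open>f = z / q\<close> follows \<open>q^2 * f' = q - z * q'\<close>,
      where the terms with \<open>a 2\<close> and \<open>p\<close> cancel and
      \<open>1 - z^2 * p'\<close> remains.\<close>
    have "((\<lambda>w. w / q w) has_field_derivative (q z - z * (- a 2 + p z + z * deriv p z)) / (q z)\<^sup>2) (at z)"
      using qz by (auto intro!: derivative_eq_intros dq simp: power2_eq_square)
    then have "(f has_field_derivative (q z - z * (- a 2 + p z + z * deriv p z)) / (q z)\<^sup>2) (at z)"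
      by (rule has_field_derivative_transform_within_open[OF _ open_ball z])
         (use fq qp in \<open>auto simp: q_def\<close>)
    then have "deriv f z = (q z - z * (- a 2 + p z + z * deriv p z)) / (q z)\<^sup>2"
      by (rule DERIV_imp_deriv)
    moreover have "recip_quot f z = q z" using qp[OF z] by (simp add: q_def)
    ultimately show ?thesis
      using qz by (simp add: U_op_def) (simp add: q_def power2_eq_square algebra_simps)
  qed
  moreover have "p 0 = 0" by (simp add: p_def s_def)
  ultimately show ?thesis
    using that hp qp q0 fq by blast
qed

text \<open>On the circle of radius \<open>\<rho>\<close> the factor \<open>z^2\<close> has constant
  modulus, so the maximum principle for \<open>deriv p\<close> gives \<open>lam / \<rho>^2\<close>
  inside. Letting \<open>\<rho>\<close> tend to 1 removes the factor without loss, as in the Schwarz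
  lemma.\<close>

lemma deriv_bound_of_square_multiple:
  assumes hol: "p holomorphic_on ball 0 1"
    and bound: "\<And>z. z \<in> ball 0 1 \<Longrightarrow> cmod (z\<^sup>2 * deriv p z) \<le> lam"
    and z: "z \<in> ball 0 1"
  shows "cmod (deriv p z) \<le> lam"
proof -
  have hd: "deriv p holomorphic_on ball 0 1" using hol by (simp add: holomorphic_deriv)
  have *: "cmod (deriv p z) \<le> lam / \<rho>\<^sup>2" if \<rho>: "cmod z < \<rho>" "\<rho> < 1" for \<rho>
  proof -
    have \<rho>0: "\<rho> > 0" using \<rho>(1) norm_ge_zero[of z] by linarith
    have sub: "cball (0::complex) \<rho> \<subseteq> ball 0 1" using \<rho> by auto
    show ?thesis
    proof (rule maximum_modulus_frontier[of "deriv p" "ball 0 \<rho>"])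
      show "deriv p holomorphic_on interior (ball 0 \<rho>)"
        using hd sub by (auto elim!: holomorphic_on_subset)
      show "continuous_on (closure (ball 0 \<rho>)) (deriv p)"
        using hd sub \<rho>0 by (auto intro: holomorphic_on_imp_continuous_on holomorphic_on_subset)
      fix w assume "w \<in> frontier (ball (0::complex) \<rho>)"
      then have w: "cmod w = \<rho>" using \<rho>0 by simp
      have "\<rho>\<^sup>2 * cmod (deriv p w) \<le> lam"
        using bound[of w] w \<rho> by (simp add: norm_mult norm_power)
      then show "cmod (deriv p w) \<le> lam / \<rho>\<^sup>2" using \<rho>0 by (simp add: field_simps)
    qed (use \<rho> in auto)
  qed
  have "((\<lambda>\<rho>::real. lam / \<rho>\<^sup>2) \<longlongrightarrow> lam / 1\<^sup>2) (at_left 1)"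
    by (intro tendsto_intros) auto
  moreover have "\<forall>\<^sub>F \<rho> in at_left 1. cmod (deriv p z) \<le> lam / \<rho>\<^sup>2"
    using * z by (auto simp: eventually_at_left_field intro!: exI[of _ "cmod z"])
  ultimately show ?thesis
    using tendsto_lowerbound[of "\<lambda>\<rho>. lam / \<rho>\<^sup>2" _ "at_left (1::real)"] by force
qed

lemma lipschitz_on_ball_of_deriv_bound:
  assumes "p holomorphic_on ball 0 1" and "0 \<le> lam"
    and "\<And>z. z \<in> ball 0 1 \<Longrightarrow> cmod (deriv p z) \<le> lam"
  shows "lam-lipschitz_on (ball 0 1) p"
proof (rule lipschitz_onI[OF _ assms(2)])
  fix x y :: complex assume xy: "x \<in> ball 0 1" "y \<in> ball 0 1"
  have "(p has_field_derivative deriv p z) (at z within ball 0 1)" if "z \<in> ball 0 1" for z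
    using holomorphic_derivI[OF assms(1) open_ball that] by (rule has_field_derivative_at_within)
  then have "cmod (p x - p y) \<le> lam * cmod (x - y)"
    using xy assms(3) by (intro field_differentiable_bound[of "ball 0 1" p "deriv p"]) auto
  then show "dist (p x) (p y) \<le> lam * dist x y" by (simp add: dist_norm)
qed

text \<open>For \<open>w = 1/z\<close> the value is \<open>z\<close> if \<open>cmod z < 1\<close>
  and the mirror image \<open>1 / cnj z\<close> otherwise: the arguments of \<open>\<phi>\<close> in
  the two formulas for \<open>F\<close>. The branches agree on the circle, where
  \<open>cnj w = 1 / w\<close>.\<close>

definition fold_disc :: "complex \<Rightarrow> complex" where
  "fold_disc w = (if cmod w \<le> 1 then cnj w else 1 / w)"

lemma fold_disc_in_cball: "fold_disc w \<in> cball 0 1"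
proof (cases "cmod w \<le> 1")
  case False
  then have "1 / cmod w \<le> 1" by (simp add: divide_le_eq_1)
  with False show ?thesis by (simp add: fold_disc_def norm_divide)
qed (simp add: fold_disc_def)

text \<open>The squares of \<open>cmod (1 - v * cnj w)\<close> and \<open>cmod (w - v)\<close>
  differ by \<open>(1 - |v|^2) * (1 - |w|^2)\<close>, which is not positive when the circle
  separates the points. The division by \<open>v\<close> only decreases the left side.\<close>

lemma cmod_diff_fold_disc_mixed:
  assumes "cmod w \<le> 1" and "1 < cmod v"
  shows "cmod (cnj w - 1 / v) \<le> cmod (w - v)"
proof -
  have v: "v \<noteq> 0" using assms by auto
  have id: "(cmod (1 - v * cnj w))\<^sup>2 = (cmod (w - v))\<^sup>2 + (1 - (cmod v)\<^sup>2) * (1 - (cmod w)\<^sup>2)"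
    by (simp only: cmod_power2) (simp add: power2_eq_square algebra_simps)
  have "(1 - (cmod v)\<^sup>2) * (1 - (cmod w)\<^sup>2) \<le> 0"
    using assms by (intro mult_nonpos_nonneg) (auto simp: power_le_one less_imp_le one_le_power)
  then have "(cmod (1 - v * cnj w))\<^sup>2 \<le> (cmod (w - v))\<^sup>2" using id by simp
  then have *: "cmod (1 - v * cnj w) \<le> cmod (w - v)" by simp
  have "cnj w - 1 / v = - ((1 - v * cnj w) / v)" using v by (simp add: field_simps)
  then have "cmod (cnj w - 1 / v) = cmod (1 - v * cnj w) / cmod v"
    by (simp add: norm_divide)
  also have "\<dots> \<le> cmod (1 - v * cnj w) / 1"
    using assms by (intro divide_left_mono) auto
  finally show ?thesis using * by simp
qed

lemma lipschitz_fold_disc: "cmod (fold_disc w - fold_disc v) \<le> cmod (w - v)"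
proof (cases "cmod w \<le> 1"; cases "cmod v \<le> 1")
  assume "cmod w \<le> 1" "cmod v \<le> 1"
  then show ?thesis by (simp add: fold_disc_def flip: complex_cnj_diff)
next
  assume "cmod w \<le> 1" "\<not> cmod v \<le> 1"
  then show ?thesis using cmod_diff_fold_disc_mixed[of w v] by (simp add: fold_disc_def)
next
  assume "\<not> cmod w \<le> 1" "cmod v \<le> 1"
  then show ?thesis using cmod_diff_fold_disc_mixed[of v w]
    by (simp add: fold_disc_def norm_minus_commute)
next
  assume *: "\<not> cmod w \<le> 1" "\<not> cmod v \<le> 1"
  then have "w \<noteq> 0" "v \<noteq> 0" by auto
  then have "1 / w - 1 / v = (v - w) / (w * v)" by (simp add: field_simps)
  then have "cmod (1 / w - 1 / v) = cmod (w - v) / (cmod w * cmod v)"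
    by (simp add: norm_divide norm_mult norm_minus_commute)
  also have "\<dots> \<le> cmod (w - v) / 1"
    using * mult_mono[of 1 "cmod w" 1 "cmod v"] by (intro divide_left_mono) auto
  finally show ?thesis using * by (simp add: fold_disc_def)
qed

lemma homeomorphism_lipschitz_perturbation:
  fixes G :: "complex \<Rightarrow> complex"
  assumes lam: "0 \<le> lam" "lam < 1"
    and G: "\<And>w v. cmod (G w - G v - (w - v)) \<le> lam * cmod (w - v)"
  shows "\<exists>K. homeomorphism UNIV UNIV G K"
proof -
  have lower: "(1 - lam) * cmod (w - v) \<le> cmod (G w - G v)" for w v
    using G[of w v] norm_triangle_ineq2[of "w - v" "w - v - (G w - G v)"]
    by (simp add: norm_minus_commute algebra_simps)
  have cont: "continuous_on UNIV G"
  proof -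
    have "(1 + lam)-lipschitz_on UNIV G"
    proof (rule lipschitz_onI)
      fix w v
      show "dist (G w) (G v) \<le> (1 + lam) * dist w v"
        using G[of w v] norm_triangle_ineq2[of "G w - G v" "w - v"]
        by (simp add: dist_norm algebra_simps)
    qed (use lam in auto)
    then show ?thesis by (rule lipschitz_on_continuous_on)
  qed
  have inj: "inj G"
  proof (rule injI)
    fix w v assume "G w = G v"
    then have "(1 - lam) * cmod (w - v) \<le> 0" using lower[of w v] by simp
    then show "w = v" using lam by (simp add: mult_le_0_iff)
  qed
  have surj: "surj G"
    unfolding surj_def
  proof
    fix y
    \<comment> \<open>A fixed point of this \<open>lam\<close>-contraction is a preimage of
      \<open>y\<close>.\<close>
    have "\<exists>!w. w - G w + y = w"
    proof (rule banach_fix_type[OF lam], intro allI)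
      fix w v show "dist (w - G w + y) (v - G v + y) \<le> lam * dist w v"
        using G[of w v] by (simp add: dist_norm norm_minus_commute algebra_simps)
    qed
    then obtain w where "w - G w + y = w" by blast
    then have "y = G w" by (simp add: algebra_simps)
    then show "\<exists>w. y = G w" ..
  qed
  show ?thesis
    using invariance_of_domain_homeomorphism[OF open_UNIV cont _ inj] surj by (metis order_refl)
qed

text \<open>The difference quotient of \<open>1 / H (1/w)\<close> factors as
  \<open>A w * B w\<close>, where \<open>A\<close> is a difference quotient of \<open>H\<close> and
  \<open>B\<close> is continuous and nonzero at \<open>z\<close>. The disc around \<open>c\<close>
  thus turns into one around \<open>c * B z\<close>.\<close>

lemma nearly_linear_reciprocal:
  assumes z: "z \<noteq> 0" "H (1 / z) \<noteq> 0" and cont: "isCont H (1 / z)" and H: "nearly_linear H (1 / z)"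
  shows "nearly_linear (\<lambda>w. 1 / H (1 / w)) z"
proof -
  obtain c k where c: "c \<noteq> 0" "k < 1"
      "\<forall>\<^sub>F w in at (1 / z). cmod ((H w - H (1 / z)) / (w - 1 / z) - c) \<le> k * cmod c"
    using H unfolding nearly_linear_def by blast
  have cinv: "isCont (\<lambda>w. 1 / w) z" using z by (intro continuous_intros) auto
  have cH: "isCont (\<lambda>w. H (1 / w)) z" by (rule isCont_o2[OF cinv cont])
  define A where "A = (\<lambda>w. (H (1 / w) - H (1 / z)) / (1 / w - 1 / z))"
  define B where "B = (\<lambda>w. 1 / (w * z * H (1 / w) * H (1 / z)))"
  have cB: "isCont B z" unfolding B_def using z cH by (intro continuous_intros) auto
  have b: "B z \<noteq> 0" using z by (simp add: B_def)
  \<comment> \<open>The midpoint between \<open>k\<close> and 1 leaves room for the variation of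
    \<open>B\<close> near \<open>z\<close>.\<close>
  define k' where "k' = (k + 1) / 2"
  have k': "k < k'" "k' < 1" using c(2) by (auto simp: k'_def)
  have "(\<lambda>w. k * cmod (B w) + cmod (B w - B z)) \<midarrow>z\<rightarrow> k * cmod (B z) + cmod (B z - B z)"
    using cB by (intro tendsto_intros) (auto simp: isCont_def)
  moreover have "k * cmod (B z) + cmod (B z - B z) < k' * cmod (B z)" using k' b by simp
  ultimately have evB: "\<forall>\<^sub>F w in at z. k * cmod (B w) + cmod (B w - B z) < k' * cmod (B z)"
    by (rule order_tendstoD)
  have "filterlim (\<lambda>w. 1 / w) (at (1 / z)) (at z)"
    using cinv z by (auto simp: filterlim_at isCont_def eventually_at_filter intro!: always_eventually)
  from eventually_compose_filterlim[OF c(3) this]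
  have evA: "\<forall>\<^sub>F w in at z. cmod (A w - c) \<le> k * cmod c" by (simp add: A_def)
  have ne: "\<forall>\<^sub>F w in at z. w \<noteq> z \<and> w \<noteq> 0 \<and> H (1 / w) \<noteq> 0"
  proof -
    have "\<forall>\<^sub>F w in at z. w \<noteq> z" by (simp add: eventually_at_filter)
    moreover have "\<forall>\<^sub>F w in at z. w \<noteq> 0"
      using z(1) tendsto_imp_eventually_ne[OF tendsto_ident_at] by blast
    moreover have "\<forall>\<^sub>F w in at z. H (1 / w) \<noteq> 0"
      using z(2) cH tendsto_imp_eventually_ne unfolding isCont_def by blast
    ultimately show ?thesis by eventually_elim auto
  qed
  have "\<forall>\<^sub>F w in at z. cmod ((1 / H (1 / w) - 1 / H (1 / z)) / (w - z) - c * B z) \<le> k' * cmod (c * B z)"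
    using evA evB ne
  proof eventually_elim
    fix w assume w: "cmod (A w - c) \<le> k * cmod c" "k * cmod (B w) + cmod (B w - B z) < k' * cmod (B z)"
      "w \<noteq> z \<and> w \<noteq> 0 \<and> H (1 / w) \<noteq> 0"
    have w1: "1 / w - 1 / z = - ((w - z) / (w * z))" using w z by (simp add: field_simps)
    have "(1 / H (1 / w) - 1 / H (1 / z)) / (w - z) = A w * B w"
    proof -
      have "1 / h - 1 / h0 = - ((h - h0) / (h * h0))" if "h \<noteq> 0" "h0 \<noteq> 0" for h h0 :: complex
        using that by (simp add: field_simps)
      then show ?thesis
        unfolding A_def B_def w1 using w z by simp
    qed
    then have "(1 / H (1 / w) - 1 / H (1 / z)) / (w - z) - c * B z = (A w - c) * B w + c * (B w - B z)"
      by (simp add: algebra_simps)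
    also have "cmod \<dots> \<le> cmod (A w - c) * cmod (B w) + cmod c * cmod (B w - B z)"
      by (metis norm_mult norm_triangle_ineq)
    also have "\<dots> \<le> (k * cmod c) * cmod (B w) + cmod c * cmod (B w - B z)"
      using w(1) by (intro add_right_mono mult_right_mono) auto
    also have "\<dots> = cmod c * (k * cmod (B w) + cmod (B w - B z))" by (simp add: algebra_simps)
    also have "\<dots> \<le> cmod c * (k' * cmod (B z))"
      using w(2) by (intro mult_left_mono) auto
    finally show "cmod ((1 / H (1 / w) - 1 / H (1 / z)) / (w - z) - c * B z) \<le> k' * cmod (c * B z)"
      by (simp add: norm_mult mult_ac)
  qed
  then show ?thesis
    unfolding nearly_linear_def using k' c(1) b by (intro exI[of _ "c * B z"] exI[of _ k']) auto
qed

text \<open>\<open>P\<close> extends \<open>p\<close> to the closed disc and so gives a meaning to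
  \<open>\<phi>(z) = z * P z\<close> on the unit circle; \<open>c\<close> stands for the coefficient
  \<open>a 2\<close>.\<close>

context
  fixes f p P :: "complex \<Rightarrow> complex" and c :: complex and lam :: real
  assumes lam: "0 \<le> lam" "lam < 1"
    and f: "f holomorphic_on ball 0 1" "deriv f 0 = 1"
    and p: "p holomorphic_on ball 0 1" "\<And>z. z \<in> ball 0 1 \<Longrightarrow> cmod (deriv p z) \<le> lam"
    and P: "lam-lipschitz_on (cball 0 1) P" "\<And>z. z \<in> ball 0 1 \<Longrightarrow> P z = p z"
    and q0: "\<And>z. z \<in> ball 0 1 \<Longrightarrow> 1 - c * z + z * p z \<noteq> 0"
    and fq: "\<And>z. z \<in> ball 0 1 \<Longrightarrow> f z = z / (1 - c * z + z * p z)"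
begin

definition reciprocal_ext :: "complex \<Rightarrow> complex" where
  "reciprocal_ext w = w - c + P (fold_disc w)"

lemma reciprocal_ext_perturbation: "cmod (reciprocal_ext w - reciprocal_ext v - (w - v)) \<le> lam * cmod (w - v)"
proof -
  have "cmod (P (fold_disc w) - P (fold_disc v)) \<le> lam * cmod (fold_disc w - fold_disc v)"
    using lipschitz_onD[OF P(1) fold_disc_in_cball fold_disc_in_cball] by (simp add: dist_norm)
  also have "\<dots> \<le> lam * cmod (w - v)"
    using lam by (intro mult_left_mono lipschitz_fold_disc)
  finally show ?thesis by (simp add: reciprocal_ext_def algebra_simps)
qed

lemma lip_at_reciprocal_ext: "lip_at reciprocal_ext z"
proof (rule lipschitz_on_UNIV_imp_lip_at)
  show "(1 + lam)-lipschitz_on UNIV reciprocal_ext"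
  proof (rule lipschitz_onI)
    fix w v
    show "dist (reciprocal_ext w) (reciprocal_ext v) \<le> (1 + lam) * dist w v"
      using reciprocal_ext_perturbation[of w v] norm_triangle_ineq2[of "reciprocal_ext w - reciprocal_ext v" "w - v"]
      by (simp add: dist_norm algebra_simps)
  qed (use lam in auto)
qed

lemma dilatation_le_at_reciprocal_ext:
  assumes "z \<notin> sphere 0 1"
  shows "dilatation_le_at lam reciprocal_ext z"
proof (cases "cmod z < 1")
  case True
  then have z: "z \<in> ball 0 1" "cnj z \<in> ball 0 1" by auto
  have "(p has_derivative (\<lambda>h. deriv p (cnj z) * h)) (at (cnj z))"
    using holomorphic_derivI[OF p(1) open_ball z(2)] by (simp add: has_field_derivative_def)
  from has_derivative_compose[OF bounded_linear_imp_has_derivative[OF bounded_linear_cnj] this]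
  have "((\<lambda>w. w - c + p (cnj w)) has_derivative (\<lambda>h. 1 * h + deriv p (cnj z) * cnj h)) (at z)"
    by (auto intro!: derivative_eq_intros)
  then have "(reciprocal_ext has_derivative (\<lambda>h. 1 * h + deriv p (cnj z) * cnj h)) (at z)"
    by (rule has_derivative_transform_within_open[OF _ open_ball z(1)])
       (auto simp: reciprocal_ext_def fold_disc_def P(2))
  then show ?thesis using p(2)[OF z(2)] unfolding dilatation_le_at_def by (intro exI[of _ 1] exI[of _ "deriv p (cnj z)"]) auto
next
  case False
  have op: "open (- cball (0::complex) 1)" by (simp add: open_Compl)
  have z: "z \<in> - cball 0 1" using False assms by auto
  have inv: "1 / w \<in> ball 0 1" if "w \<in> - cball 0 1" for w :: complex
    using that by (auto simp: norm_divide divide_less_eq_1)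
  have "(\<lambda>w. w - c + p (1 / w)) holomorphic_on - cball 0 1"
    using inv by (intro holomorphic_intros holomorphic_on_compose_gen[OF _ p(1), unfolded o_def]) auto
  from dilatation_le_at_holomorphic[OF lam(1) this op z] have "dilatation_le_at lam (\<lambda>w. w - c + p (1 / w)) z" .
  then show ?thesis
  proof (rule dilatation_le_at_cong[rotated])
    show "\<forall>\<^sub>F w in nhds z. reciprocal_ext w = w - c + p (1 / w)"
      using eventually_nhds_in_open[OF op z]
      by eventually_elim (use inv P(2) in \<open>auto simp: reciprocal_ext_def fold_disc_def\<close>)
  qed
qed

text \<open>Besides showing that \<open>f\<close> is extended, this identity settles the behaviour
  at infinity: the expression in the coordinates \<open>1/z\<close> is \<open>f\<close> there, off
  the origin.\<close>

lemma reciprocal_ext_reciprocal: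
  assumes "w \<in> ball 0 1" and "w \<noteq> 0"
  shows "reciprocal_ext (1 / w) \<noteq> 0" and "1 / reciprocal_ext (1 / w) = f w"
proof -
  have "\<not> cmod (1 / w) \<le> 1" using assms by (simp add: norm_divide field_simps)
  then have "reciprocal_ext (1 / w) = (1 - c * w + w * p w) / w"
    using assms by (simp add: reciprocal_ext_def fold_disc_def P(2) field_simps)
  then show "reciprocal_ext (1 / w) \<noteq> 0" "1 / reciprocal_ext (1 / w) = f w"
    using q0[OF assms(1)] fq[OF assms(1)] assms(2) by auto
qed

definition reflection_ext :: "riemann_sphere \<Rightarrow> riemann_sphere" where
  "reflection_ext = sphere_inv \<circ> fix_infinity reciprocal_ext \<circ> sphere_inv"

lemma reflection_ext_Some: "reflection_ext (Some z) = (if z = 0 then Some 0 else sphere_div 1 (reciprocal_ext (1 / z)))"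
  by (simp add: reflection_ext_def sphere_div_def)

text \<open>The factor \<open>|z|^2\<close> turns \<open>\<phi>(1 / cnj z)\<close> into
  \<open>z * P (1 / cnj z)\<close>. For \<open>z \<noteq> 0\<close> the denominator is then
  \<open>z * reciprocal_ext (1 / z)\<close>, and \<open>z\<close> cancels.\<close>

lemma reflection_ext_formula:
  "reflection_ext (Some z) =
     (if cmod z < 1 then sphere_div z (1 - c * z + z * P z)
      else sphere_div z (1 - c * z + of_real ((cmod z)\<^sup>2) * (1 / cnj z * P (1 / cnj z))))"
proof (cases "z = 0")
  case False
  have div: "sphere_div z (z * g) = sphere_div 1 g" for g
    using False by (simp add: sphere_div_def)
  have "1 - c * z + of_real ((cmod z)\<^sup>2) * (1 / cnj z * P (1 / cnj z)) = 1 - c * z + z * P (1 / cnj z)"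
    using False by (simp only: complex_norm_square) simp
  moreover have "fold_disc (1 / z) = (if cmod z < 1 then z else 1 / cnj z)"
    using False by (auto simp: fold_disc_def norm_divide divide_le_eq_1 not_less)
  ultimately show ?thesis
    using False by (auto simp: reflection_ext_Some reciprocal_ext_def algebra_simps simp flip: div)
qed (simp add: reflection_ext_Some sphere_div_def)

lemma reflection_ext_disc: "z \<in> ball 0 1 \<Longrightarrow> reflection_ext (Some z) = Some (f z)"
  using reciprocal_ext_reciprocal[of z] fq[of 0] by (auto simp: reflection_ext_Some sphere_div_def)

text \<open>The origin is infinity in the coordinate \<open>1/z\<close>, so it is treated by means
  of \<open>f\<close>, whose derivative there is 1. All other points inherit the properties of
  \<open>reciprocal_ext\<close>.\<close>

lemma chart_reflection_ext:
  assumes "z \<in> chart_dom id id reflection_ext"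
  shows "lip_at (chart_rep id id reflection_ext) z \<and> nearly_linear (chart_rep id id reflection_ext) z"
proof (cases "z = 0")
  case True
  have "\<forall>\<^sub>F w in nhds z. chart_rep id id reflection_ext w = f w"
    using eventually_nhds_in_open[OF open_ball, of 0 0 1] True
    by (auto simp: chart_rep_def reflection_ext_disc elim!: eventually_mono)
  moreover have "lip_at f z" using f(1) True by (intro lip_at_holomorphic[of f "ball 0 1"]) auto
  moreover have "nearly_linear f z"
    using holomorphic_derivI[OF f(1) open_ball, of 0] f(2) True by (intro nearly_linear_deriv[of f 1]) auto
  ultimately show ?thesis by (metis lip_at_cong nearly_linear_cong)
next
  case False
  have Gz: "reciprocal_ext (1 / z) \<noteq> 0"
    using assms False by (auto simp: chart_dom_def reflection_ext_Some sphere_div_def split: if_splits)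
  have "isCont (\<lambda>w. reciprocal_ext (1 / w)) z"
    by (rule isCont_o2[OF _ lip_at_isCont[OF lip_at_reciprocal_ext]]) (use False in \<open>auto intro!: continuous_intros\<close>)
  then have "\<forall>\<^sub>F w in nhds z. reciprocal_ext (1 / w) \<noteq> 0"
    using Gz tendsto_imp_eventually_ne[of "\<lambda>w. reciprocal_ext (1 / w)" _ "at z"]
    by (auto simp: isCont_def eventually_nhds_conv_at)
  moreover have "\<forall>\<^sub>F w in nhds z. w \<noteq> 0"
    using eventually_nhds_in_open[OF open_Compl[OF closed_singleton], of z 0] False by simp
  ultimately have "\<forall>\<^sub>F w in nhds z. chart_rep id id reflection_ext w = 1 / reciprocal_ext (1 / w)"
    by eventually_elim (simp add: chart_rep_def reflection_ext_Some sphere_div_def)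
  moreover have "lip_at (\<lambda>w. 1 / reciprocal_ext (1 / w)) z"
    by (rule lip_at_compose[OF lip_at_compose[OF lip_at_inverse lip_at_reciprocal_ext] lip_at_inverse])
       (use False Gz in auto)
  moreover have "nearly_linear reciprocal_ext (1 / z)"
  proof -
    \<comment> \<open>Every difference quotient of \<open>reciprocal_ext\<close> lies within
      \<open>lam\<close> of 1, also at points of the unit circle.\<close>
    have "\<forall>\<^sub>F w in at (1 / z). cmod ((reciprocal_ext w - reciprocal_ext (1 / z)) / (w - 1 / z) - 1) \<le> lam * cmod 1"
      unfolding eventually_at_filter
    proof (intro always_eventually allI impI)
      fix w assume w: "w \<noteq> 1 / z"
      let ?v = "1 / z"
      have "(reciprocal_ext w - reciprocal_ext ?v) / (w - ?v) - 1 = (reciprocal_ext w - reciprocal_ext ?v - (w - ?v)) / (w - ?v)"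
        using w by (simp add: diff_divide_distrib)
      then show "cmod ((reciprocal_ext w - reciprocal_ext ?v) / (w - ?v) - 1) \<le> lam * cmod 1"
        using reciprocal_ext_perturbation[of w ?v] w by (simp add: norm_divide divide_le_eq)
    qed
    then show ?thesis unfolding nearly_linear_def using lam by (intro exI[of _ 1] exI[of _ lam]) auto
  qed
  then have "nearly_linear (\<lambda>w. 1 / reciprocal_ext (1 / w)) z"
    by (intro nearly_linear_reciprocal lip_at_isCont[OF lip_at_reciprocal_ext]) (use False Gz in auto)
  ultimately show ?thesis by (metis lip_at_cong nearly_linear_cong)
qed

lemma quasiconformal_reflection_ext: "quasiconformal lam reflection_ext"
proof -
  obtain K where K: "homeomorphism UNIV UNIV reciprocal_ext K"
    using homeomorphism_lipschitz_perturbation[OF lam reciprocal_ext_perturbation] by blast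
  have "homeomorphic_map sphere_topology sphere_topology reflection_ext"
    unfolding reflection_ext_def
    by (intro homeomorphic_map_compose[where Y = sphere_topology] homeomorphic_map_sphere_inv
        homeomorphic_map_fix_infinity[OF K])
  moreover have "sense_preserving reflection_ext"
    using chart_reflection_ext by (intro sense_preservingI) auto
  moreover have "charts_dilatation lam reflection_ext"
    unfolding reflection_ext_def
  proof (intro charts_dilatation_sphere_inv charts_dilatation_fix_infinity lam lip_at_reciprocal_ext)
    show "dilatation_le_at lam reciprocal_ext z" if "z \<notin> sphere 0 1 \<union> {0}" for z
      using that dilatation_le_at_reciprocal_ext by auto
    have ev: "\<forall>\<^sub>F w in nhds 0. w \<in> ball (0::complex) 1"
      by (intro eventually_nhds_in_open) auto
    then show "\<forall>\<^sub>F w in at 0. reciprocal_ext (1 / w) \<noteq> 0"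
      unfolding eventually_at_filter by eventually_elim (use reciprocal_ext_reciprocal in auto)
    have "\<forall>\<^sub>F w in nhds 0. (if w = 0 then 0 else 1 / reciprocal_ext (1 / w)) = f w"
      using ev fq[of 0] by (auto elim!: eventually_mono simp: reciprocal_ext_reciprocal)
    then show "lip_at (\<lambda>w. if w = 0 then 0 else 1 / reciprocal_ext (1 / w)) 0"
      by (rule lip_at_cong) (use f(1) in \<open>auto intro!: lip_at_holomorphic[of f "ball 0 1"]\<close>)
  qed
  ultimately show ?thesis
    using lam unfolding quasiconformal_def charts_dilatation_def by blast
qed

end

section \<open>The reflected map as an extension of \<open>f\<close>\<close>

lemma qc_extensionI:
  assumes "quasiconformal k F" and "open \<Omega>" and "connected \<Omega>" and "f holomorphic_on \<Omega>"
    and "\<And>z. z \<in> \<Omega> \<Longrightarrow> F (Some z) = Some (f z)"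
  shows "qc_extension k \<Omega> f F"
proof -
  \<comment> \<open>Injectivity of \<open>f\<close> is inherited from the homeomorphism
    \<open>F\<close> rather than derived from the class.\<close>
  have "inj_on F UNIV"
    using assms(1) homeomorphic_imp_injective_map[of sphere_topology sphere_topology F]
    by (simp add: quasiconformal_def topspace_sphere_topology)
  then have "inj_on f \<Omega>"
    using assms(5) by (intro inj_onI) (metis UNIV_I inj_onD option.inject)
  then show ?thesis using assms by (simp add: qc_extension_def)
qed

lemma class_U_extension:
  assumes lam: "0 < lam" "lam < 1" and f: "f \<in> class_U lam"
    and a: "\<And>z. z \<in> ball 0 1 \<Longrightarrow> (\<lambda>n. a (n + 2) * z ^ (n + 2)) sums (f z - z)"
  shows "phi f (a 2) 0 = 0"
    and "(phi f (a 2) has_field_derivative 0) (at 0)"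
    and "\<And>z. z \<in> ball 0 1 \<Longrightarrow> f z = z / (1 - a 2 * z + phi f (a 2) z)"
    and "\<exists>\<Phi> F. continuous_on (cball 0 1) \<Phi> \<and>
          (\<forall>z\<in>ball 0 1. \<Phi> z = phi f (a 2) z) \<and>
          (\<forall>z. F (Some z) =
            (if cmod z < 1 then sphere_div z (1 - a 2 * z + \<Phi> z)
             else sphere_div z (1 - a 2 * z + of_real ((cmod z)\<^sup>2) * \<Phi> (1 / cnj z)))) \<and>
          qc_extension lam (ball 0 1) f F"
proof -
  obtain p where hp: "p holomorphic_on ball 0 1" and p0: "p 0 = 0"
    and q: "\<And>z. z \<in> ball 0 1 \<Longrightarrow> recip_quot f z = 1 - a 2 * z + z * p z"
    and q0: "\<And>z. z \<in> ball 0 1 \<Longrightarrow> recip_quot f z \<noteq> 0"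
    and fq: "\<And>z. z \<in> ball 0 1 \<Longrightarrow> f z = z / recip_quot f z"
    and U: "\<And>z. z \<in> ball 0 1 \<Longrightarrow> U_op f z = - (z\<^sup>2 * deriv p z)"
    using class_U_recip_quot[OF less_imp_le[OF lam(2)] f a] by metis
  have phi: "phi f (a 2) z = z * p z" if "z \<in> ball 0 1" for z
    using q[OF that] by (simp add: phi_def)
  show "phi f (a 2) 0 = 0" by (simp add: phi)
  show "f z = z / (1 - a 2 * z + phi f (a 2) z)" if "z \<in> ball 0 1" for z
    using fq[OF that] q[OF that] phi[OF that] by simp
  have "((\<lambda>z. z * p z) has_field_derivative 0) (at 0)"
    using p0 holomorphic_derivI[OF hp open_ball, of 0] by (auto intro!: derivative_eq_intros)
  then show "(phi f (a 2) has_field_derivative 0) (at 0)"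
    by (rule has_field_derivative_transform_within_open[of _ _ _ "ball 0 1"]) (auto simp: phi)
  have "cmod (z\<^sup>2 * deriv p z) \<le> lam" if "z \<in> ball 0 1" for z
  proof -
    have "cmod (U_op f z) \<le> lam" using f that by (auto simp: class_U_def less_imp_le)
    then show ?thesis by (simp add: U[OF that])
  qed
  then have dp: "\<And>z. z \<in> ball 0 1 \<Longrightarrow> cmod (deriv p z) \<le> lam"
    using deriv_bound_of_square_multiple[OF hp] by blast
  then have "lam-lipschitz_on (ball 0 1) p"
    using lam hp by (intro lipschitz_on_ball_of_deriv_bound) auto
  \<comment> \<open>The extension to the closed disc keeps the constant \<open>lam\<close> and
    provides the boundary values of \<open>\<phi>\<close>.\<close>
  from lipschitz_extend_closure[OF this] obtain P
    where P: "lam-lipschitz_on (cball 0 1) P" "\<And>z. z \<in> ball 0 1 \<Longrightarrow> P z = p z"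
    by auto
  have hf: "f holomorphic_on ball 0 1" "deriv f 0 = 1" using f by (auto simp: class_U_def class_A_def)
  note ctx = less_imp_le[OF lam(1)] lam(2) hf hp dp P
  have q0': "1 - a 2 * z + z * p z \<noteq> 0" and fq': "f z = z / (1 - a 2 * z + z * p z)" if "z \<in> ball 0 1" for z
    using q0[OF that] q[OF that] fq[OF that] by auto
  let ?F = "reflection_ext P (a 2)"
  have "continuous_on (cball 0 1) (\<lambda>z. z * P z)"
    by (intro continuous_intros lipschitz_on_continuous_on[OF P(1)])
  moreover have "qc_extension lam (ball 0 1) f ?F"
    by (intro qc_extensionI quasiconformal_reflection_ext[OF ctx q0' fq'] reflection_ext_disc[OF ctx q0' fq'] hf) auto
  ultimately show "\<exists>\<Phi> F. continuous_on (cball 0 1) \<Phi> \<and>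
          (\<forall>z\<in>ball 0 1. \<Phi> z = phi f (a 2) z) \<and>
          (\<forall>z. F (Some z) =
            (if cmod z < 1 then sphere_div z (1 - a 2 * z + \<Phi> z)
             else sphere_div z (1 - a 2 * z + of_real ((cmod z)\<^sup>2) * \<Phi> (1 / cnj z)))) \<and>
          qc_extension lam (ball 0 1) f F"
    using reflection_ext_formula[OF ctx q0' fq'] P(2) phi
    by (intro exI[of _ "\<lambda>z. z * P z"] exI[of _ ?F] conjI) auto
qed

section \<open>Wirtinger derivatives and disc automorphisms\<close>

text \<open>In contrast to \<open>dilatation_le_at\<close> the two coefficients are named, so that
  product and quotient rules can compute them.\<close>

definition has_wirtinger_derivs ::
  "(complex \<Rightarrow> complex) \<Rightarrow> complex \<Rightarrow> complex \<Rightarrow> complex \<Rightarrow> bool" where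
  "has_wirtinger_derivs g \<alpha> \<beta> z \<longleftrightarrow> (g has_derivative (\<lambda>h. \<alpha> * h + \<beta> * cnj h)) (at z)"

lemma has_wirtinger_derivs_linear: "has_wirtinger_derivs (\<lambda>w. b * w) b 0 z"
  using has_derivative_mult_right[OF has_derivative_ident, of b "at z"]
  by (simp add: has_wirtinger_derivs_def)

text \<open>The derivative \<open>h \<bullet> sgn z\<close> is the real part of
  \<open>h * cnj z / |z|\<close>, and a real part is half the sum of a number and its
  conjugate.\<close>

lemma has_wirtinger_derivs_cmod:
  assumes "z \<noteq> 0"
  shows "has_wirtinger_derivs (\<lambda>w. of_real (cmod w)) (cnj z / (2 * cmod z)) (z / (2 * cmod z)) z"
proof -
  have "((\<lambda>w. of_real (cmod w) :: complex) has_derivative (\<lambda>h. of_real (h \<bullet> sgn z))) (at z)"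
    by (rule has_derivative_of_real[OF has_derivative_norm[OF assms]])
  moreover have "(\<lambda>h. of_real (h \<bullet> sgn z)) = (\<lambda>h. cnj z / (2 * cmod z) * h + z / (2 * cmod z) * cnj h)"
  proof
    fix h
    have "h \<bullet> sgn z = (h \<bullet> z) / cmod z"
      by (simp only: sgn_div_norm inner_scaleR_right divide_inverse mult.commute)
    then have "of_real (h \<bullet> sgn z) = of_real (2 * (h \<bullet> z)) / (2 * complex_of_real (cmod z))"
      by simp
    also have "of_real (2 * (h \<bullet> z)) = cnj z * h + z * cnj h"
      by (simp add: complex_eq_iff inner_complex_def)
    also have "(cnj z * h + z * cnj h) / (2 * complex_of_real (cmod z)) =
        cnj z / (2 * cmod z) * h + z / (2 * cmod z) * cnj h"
      by (simp add: add_divide_distrib)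
    finally show "of_real (h \<bullet> sgn z) = cnj z / (2 * cmod z) * h + z / (2 * cmod z) * cnj h" .
  qed
  ultimately show ?thesis unfolding has_wirtinger_derivs_def by simp
qed

lemma has_wirtinger_derivs_diff:
  assumes "has_wirtinger_derivs f \<alpha> \<beta> z" and "has_wirtinger_derivs g \<alpha>' \<beta>' z"
  shows "has_wirtinger_derivs (\<lambda>w. f w - g w) (\<alpha> - \<alpha>') (\<beta> - \<beta>') z"
  using has_derivative_diff[OF assms[unfolded has_wirtinger_derivs_def]]
  by (simp add: has_wirtinger_derivs_def algebra_simps)

lemma has_wirtinger_derivs_mult:
  assumes "has_wirtinger_derivs f \<alpha> \<beta> z" and "has_wirtinger_derivs g \<alpha>' \<beta>' z"
  shows "has_wirtinger_derivs (\<lambda>w. f w * g w) (\<alpha> * g z + f z * \<alpha>') (\<beta> * g z + f z * \<beta>') z"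
  using has_derivative_mult[OF assms[unfolded has_wirtinger_derivs_def]]
  by (simp add: has_wirtinger_derivs_def algebra_simps)

lemma has_wirtinger_derivs_divide:
  assumes "has_wirtinger_derivs f \<alpha> \<beta> z" and "has_wirtinger_derivs g \<alpha>' \<beta>' z" and "g z \<noteq> 0"
  shows "has_wirtinger_derivs (\<lambda>w. f w / g w) (\<alpha> / g z - f z * \<alpha>' / (g z)\<^sup>2) (\<beta> / g z - f z * \<beta>' / (g z)\<^sup>2) z"
proof -
  have "(\<lambda>h. ((\<alpha> * h + \<beta> * cnj h) * g z - f z * (\<alpha>' * h + \<beta>' * cnj h)) / (g z * g z)) =
    (\<lambda>h. (\<alpha> / g z - f z * \<alpha>' / (g z)\<^sup>2) * h + (\<beta> / g z - f z * \<beta>' / (g z)\<^sup>2) * cnj h)"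
    using assms(3) by (simp add: fun_eq_iff power2_eq_square divide_simps) (simp add: algebra_simps)
  then show ?thesis
    using has_derivative_divide'[OF assms(1,2)[unfolded has_wirtinger_derivs_def] assms(3)]
    by (simp add: has_wirtinger_derivs_def)
qed

text \<open>The error of \<open>h\<close> is one of the two errors and so at most their sum. This
  glues formulas that agree to first order at a point of the unit circle, whatever the sets on which
  they are used.\<close>

lemma has_derivative_pointwise_choice:
  fixes f g h :: "'a::real_normed_vector \<Rightarrow> 'b::real_normed_vector"
  assumes f: "(f has_derivative D) (at z)" and g: "(g has_derivative D) (at z)"
    and fg: "f z = g z" and h: "\<And>w. h w = f w \<or> h w = g w"
  shows "(h has_derivative D) (at z)"
proof -
  let ?e = "\<lambda>f w. norm (f w - f z - D (w - z)) / norm (w - z)"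
  have lim: "((\<lambda>w. ?e f w + ?e g w) \<longlongrightarrow> 0) (at z)"
    using tendsto_add[of "?e f" 0 "at z" "?e g" 0] f g by (simp add: has_derivative_iff_norm)
  have "((\<lambda>w. ?e h w) \<longlongrightarrow> 0) (at z)"
  proof (rule tendsto_sandwich[OF _ _ tendsto_const lim])
    have "?e h w \<le> ?e f w + ?e g w" for w
      using h[of w] h[of z] fg by auto
    then show "\<forall>\<^sub>F w in at z. ?e h w \<le> ?e f w + ?e g w" by simp
  qed simp
  then show ?thesis using f by (simp add: has_derivative_iff_norm)
qed

lemma cmod_mobius_identity:
  "(cmod (1 - a * z))\<^sup>2 - (cmod (z - cnj a))\<^sup>2 = (1 - (cmod a)\<^sup>2) * (1 - (cmod z)\<^sup>2)"
  by (simp only: cmod_power2) (simp add: power2_eq_square algebra_simps)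

text \<open>The disc automorphism that sends \<open>cnj a\<close> to 0; \<open>mobius (- a)\<close>
  inverts it on the closed disc. The index \<open>a\<close>, rather than the zero
  \<open>cnj a\<close>, gives it the denominator of \<open>z / (1 - a * z)\<close>.\<close>

definition mobius :: "complex \<Rightarrow> complex \<Rightarrow> complex" where
  "mobius a z = (z - cnj a) / (1 - a * z)"

context
  fixes a :: complex
  assumes a1: "cmod a < 1"
begin

lemma one_minus_mult_ge: "cmod z \<le> 1 \<Longrightarrow> 1 - cmod a \<le> cmod (1 - a * z)"
proof -
  assume "cmod z \<le> 1"
  then have "cmod (a * z) \<le> cmod a" by (simp add: norm_mult mult_left_le)
  then show ?thesis using norm_triangle_ineq2[of 1 "a * z"] by simp
qed

lemma one_minus_mult_nz: "cmod z \<le> 1 \<Longrightarrow> 1 - a * z \<noteq> 0"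
proof -
  assume "cmod z \<le> 1"
  then have "0 < cmod (1 - a * z)" using one_minus_mult_ge[of z] a1 by linarith
  then show ?thesis by (rule zero_less_norm_iff[THEN iffD1])
qed

lemma mobius_lt_1: "cmod z < 1 \<Longrightarrow> cmod (mobius a z) < 1"
proof -
  assume z: "cmod z < 1"
  have "0 < (1 - (cmod a)\<^sup>2) * (1 - (cmod z)\<^sup>2)"
    using z a1 by (intro mult_pos_pos) (auto simp: abs_square_less_1)
  then have "(cmod (z - cnj a))\<^sup>2 < (cmod (1 - a * z))\<^sup>2" using cmod_mobius_identity[of a z] by linarith
  then have "cmod (z - cnj a) < cmod (1 - a * z)" by (rule power_less_imp_less_base) simp
  moreover have "0 < cmod (1 - a * z)" using one_minus_mult_nz[of z] z by simp
  ultimately show ?thesis by (simp add: mobius_def norm_divide)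
qed

lemma mobius_eq_1: "cmod z = 1 \<Longrightarrow> cmod (mobius a z) = 1"
proof -
  assume z: "cmod z = 1"
  then have "(cmod (z - cnj a))\<^sup>2 = (cmod (1 - a * z))\<^sup>2" using cmod_mobius_identity[of a z] by simp
  then have "cmod (z - cnj a) = cmod (1 - a * z)" by simp
  then show ?thesis using one_minus_mult_nz[of z] z by (simp add: mobius_def norm_divide)
qed

lemma mobius_inj:
  assumes "cmod z \<le> 1" "cmod w \<le> 1" "mobius a z = mobius a w"
  shows "z = w"
proof -
  have "(z - cnj a) * (1 - a * w) = (w - cnj a) * (1 - a * z)"
    using assms(3) one_minus_mult_nz[OF assms(1)] one_minus_mult_nz[OF assms(2)]
    unfolding mobius_def by (subst (asm) frac_eq_eq)
  then have "(z - w) * (1 - a * cnj a) = 0" by (simp add: algebra_simps)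
  moreover have "1 - a * cnj a \<noteq> 0" using one_minus_mult_nz[of "cnj a"] a1 by simp
  ultimately show ?thesis by simp
qed

end

lemma mobius_mobius:
  assumes "cmod a < 1" and "cmod v \<le> 1"
  shows "mobius a (mobius (- a) v) = v"
proof -
  have nz: "1 + a * v \<noteq> 0" using one_minus_mult_nz[of "- a" v] assms by simp
  have nz2: "1 - a * cnj a \<noteq> 0" using one_minus_mult_nz[of a "cnj a"] assms by simp
  have m: "mobius (- a) v = (v + cnj a) / (1 + a * v)" by (simp add: mobius_def)
  have "mobius (- a) v - cnj a = v * (1 - a * cnj a) / (1 + a * v)"
    unfolding m using nz by (simp add: field_simps)
  moreover have "1 - a * mobius (- a) v = (1 - a * cnj a) / (1 + a * v)"
    unfolding m using nz by (simp add: field_simps)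
  ultimately show ?thesis using nz nz2 by (simp add: mobius_def)
qed

section \<open>Radial extension of a Moebius map\<close>

definition ray_ext :: "complex \<Rightarrow> complex \<Rightarrow> complex" where
  "ray_ext a z = z * ((of_real (cmod z))\<^sup>2 - a * z) / (of_real (cmod z) - a * z)\<^sup>2"

definition disc_ext :: "complex \<Rightarrow> complex \<Rightarrow> complex" where
  "disc_ext a z = (if cmod z < 1 then z / (1 - a * z) else ray_ext a z)"

context
  fixes a :: complex
  assumes a1: "cmod a < 1"
begin

text \<open>Outside the disc, the extension maps the radial ray through a point \<open>e\<close> of the unit circle
  affinely onto the outward normal of the image disc at \<open>e / (1 - a e)\<close>.\<close>

lemma ray_ext_polar:
  assumes "cmod e = 1" and "n > 0"
  shows "ray_ext a (of_real n * e) = e * (of_real n - a * e) / (1 - a * e)\<^sup>2"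
proof -
  have e: "1 - a * e \<noteq> 0" using one_minus_mult_nz[OF a1, of e] assms by simp
  have c: "cmod (of_real n * e) = n" using assms by (simp add: norm_mult)
  have "(of_real n)\<^sup>2 - a * (of_real n * e) = of_real n * (of_real n - a * e)"
    "of_real n - a * (of_real n * e) = of_real n * (1 - a * e)"
    by (simp_all add: power2_eq_square algebra_simps)
  then show ?thesis
    using assms(2) e unfolding ray_ext_def c by (simp add: power_mult_distrib) (simp add: power2_eq_square)
qed

text \<open>At \<open>n = 1\<close> the coefficients are \<open>1 / (1 - a * e)^2\<close> and 0,
  those of \<open>z / (1 - a * z)\<close>, so the two formulas fit together to first order on the
  circle. The range \<open>n > 0\<close> includes the circle, where \<open>ray_ext\<close> is needed
  on both sides.\<close>

lemma ray_ext_wirtinger: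
  assumes "cmod e = 1" and "n > 0"
  shows "has_wirtinger_derivs (ray_ext a) ((1 - a * e / of_real n) / (1 - a * e) ^ 3)
           (- (a * e ^ 3 * (1 - 1 / of_real n) / (1 - a * e) ^ 3)) (of_real n * e)"
proof -
  define z where "z = of_real n * e"
  have d: "1 - a * e \<noteq> 0" using one_minus_mult_nz[OF a1, of e] assms by simp
  have e0: "e \<noteq> 0" using assms by auto
  have n0: "complex_of_real n \<noteq> 0" using assms by simp
  have cz: "cmod z = n" using assms by (simp add: z_def norm_mult)
  have z0: "z \<noteq> 0" using e0 n0 by (simp add: z_def)
  \<comment> \<open>This relation removes all conjugates; the rest is rational in \<open>a\<close>,
    \<open>e\<close> and \<open>n\<close>.\<close>
  have "cnj e = 1 / e"
    using assms(1) complex_norm_square[of e] e0 by (simp add: field_simps)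
  then have cnjz: "cnj z = of_real n / e" by (simp add: z_def)
  have N: "has_wirtinger_derivs (\<lambda>w. of_real (cmod w)) (1 / (2 * e)) (e / 2) z"
  proof -
    have "cnj z / (2 * cmod z) = 1 / (2 * e)" "z / (2 * cmod z) = e / 2"
      using n0 e0 by (simp_all add: cz cnjz) (simp add: z_def)
    then show ?thesis using has_wirtinger_derivs_cmod[OF z0] by (simp only:)
  qed
  note L = has_wirtinger_derivs_linear[of a z]
  note I = has_wirtinger_derivs_linear[of 1 z, simplified]
  note D = has_wirtinger_derivs_diff[OF N L]
  have Dz: "of_real (cmod z) - a * z = of_real n * (1 - a * e)"
    by (simp add: cz) (simp add: z_def algebra_simps)
  have nz: "(of_real (cmod z) - a * z) * (of_real (cmod z) - a * z) \<noteq> 0"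
    using d n0 by (simp add: Dz)
  note F = has_wirtinger_derivs_divide[OF has_wirtinger_derivs_mult[OF I
      has_wirtinger_derivs_diff[OF has_wirtinger_derivs_mult[OF N N] L]] has_wirtinger_derivs_mult[OF D D] nz]
  have fn: "(\<lambda>w. w * (complex_of_real (cmod w) * complex_of_real (cmod w) - a * w) /
     ((complex_of_real (cmod w) - a * w) * (complex_of_real (cmod w) - a * w))) = ray_ext a"
    by (simp add: ray_ext_def power2_eq_square fun_eq_iff)
  define b where "b = a * e"
  have db: "1 - b \<noteq> 0" using d by (simp add: b_def)
  let ?n = "complex_of_real n"
  have ez: "a * z = ?n * b" by (simp add: z_def b_def)
  have num: "?n * ?n - a * z = ?n * (?n - b)" by (simp add: ez algebra_simps)
  have num\<alpha>: "1 * (?n * ?n - a * z) + z * (1 / (2 * e) * ?n + ?n * (1 / (2 * e)) - a) = 2 * (?n * (?n - b))"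
    using e0 by (simp add: ez) (simp add: z_def b_def algebra_simps)
  have num\<beta>: "0 * (?n * ?n - a * z) + z * (e / 2 * ?n + ?n * (e / 2) - 0) = ?n * ?n * (e * e)"
    by (simp add: z_def)
  have den\<alpha>: "(1 / (2 * e) - a) * (?n * (1 - a * e)) + ?n * (1 - a * e) * (1 / (2 * e) - a) = ?n * (1 - b) * (1 - 2 * b) / e"
    using e0 by (simp add: b_def field_simps)
  have den\<beta>: "(e / 2 - 0) * (?n * (1 - a * e)) + ?n * (1 - a * e) * (e / 2 - 0) = ?n * (1 - b) * e"
    by (simp add: b_def field_simps)
  have \<alpha>: "2 * (?n * (?n - b)) / (?n * (1 - b) * (?n * (1 - b))) -
      z * (?n * (?n - b)) * (?n * (1 - b) * (1 - 2 * b) / e) / (?n * (1 - b) * (?n * (1 - b)))\<^sup>2 =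
      (1 - b / ?n) / (1 - b) ^ 3"
  proof -
    have "z * (?n * (?n - b)) * (?n * (1 - b) * (1 - 2 * b) / e) = ?n ^ 3 * (?n - b) * (1 - b) * (1 - 2 * b)"
      using e0 by (simp add: z_def power3_eq_cube)
    \<comment> \<open>Up to the factor \<open>1 - b / m\<close> this is
      \<open>2 / c^2 - (2 * c - 1) / c^3 = 1 / c^3\<close>; for \<open>c = 1 - b\<close> the number
      \<open>2 * c - 1\<close> is \<open>1 - 2 * b\<close>.\<close>
    moreover have "2 * (m * (m - b)) / (m * c * (m * c)) - m ^ 3 * (m - b) * c * (2 * c - 1) / (m * c * (m * c))\<^sup>2
        = (1 - b / m) / c ^ 3" if "m \<noteq> 0" "c \<noteq> 0" for m c :: complex
      using that by (simp add: divide_simps power2_eq_square power3_eq_cube) (simp add: algebra_simps)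
    from this[OF n0 db] have "2 * (?n * (?n - b)) / (?n * (1 - b) * (?n * (1 - b))) -
        ?n ^ 3 * (?n - b) * (1 - b) * (1 - 2 * b) / (?n * (1 - b) * (?n * (1 - b)))\<^sup>2 = (1 - b / ?n) / (1 - b) ^ 3"
      by simp
    ultimately show ?thesis by simp
  qed
  have \<beta>: "?n * ?n * (e * e) / (?n * (1 - b) * (?n * (1 - b))) -
      z * (?n * (?n - b)) * (?n * (1 - b) * e) / (?n * (1 - b) * (?n * (1 - b)))\<^sup>2 =
      - (a * e ^ 3 * (1 - 1 / ?n) / (1 - b) ^ 3)"
  proof -
    have "a * e ^ 3 = b * (e * e)" by (simp add: b_def power3_eq_cube)
    \<comment> \<open>With \<open>b = 1 - c\<close>, the difference
      \<open>1 / c^2 - (1 - b / m) / c^3\<close> is \<open>- b * (1 - 1 / m) / c^3\<close>.\<close>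
    moreover have "m * m * (e * e) / (m * c * (m * c)) - m * e * (m * (m - b)) * (m * c * e) / (m * c * (m * c))\<^sup>2
        = - (b * (e * e) * (1 - 1 / m) / c ^ 3)" if "m \<noteq> 0" "c \<noteq> 0" "b = 1 - c" for m c :: complex
      using that(1,2) unfolding that(3)
      by (simp add: divide_simps power2_eq_square power3_eq_cube) (simp add: algebra_simps)
    from this[OF n0 db] have "?n * ?n * (e * e) / (?n * (1 - b) * (?n * (1 - b))) -
      z * (?n * (?n - b)) * (?n * (1 - b) * e) / (?n * (1 - b) * (?n * (1 - b)))\<^sup>2 =
      - (b * (e * e) * (1 - 1 / ?n) / (1 - b) ^ 3)" by (simp add: z_def)
    ultimately show ?thesis by simp
  qed
  have ae: "a * e = b" by (simp add: b_def)
  show ?thesis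
    using F unfolding fn Dz unfolding cz num\<alpha> num\<beta> den\<alpha> den\<beta> unfolding num unfolding ae unfolding \<alpha> \<beta>
    by (simp only: z_def)
qed

lemma disc_wirtinger:
  assumes "cmod z \<le> 1"
  shows "has_wirtinger_derivs (\<lambda>w. w / (1 - a * w)) (1 / (1 - a * z)\<^sup>2) 0 z"
proof -
  have d: "1 - a * z \<noteq> 0" using one_minus_mult_nz[OF a1 assms] .
  have "((\<lambda>w. w / (1 - a * w)) has_field_derivative (1 / (1 - a * z)\<^sup>2)) (at z)"
    using d by (auto intro!: derivative_eq_intros simp: power2_eq_square)
  moreover have "(\<lambda>h. 1 / (1 - a * z)\<^sup>2 * h + 0 * cnj h) = (*) (1 / (1 - a * z)\<^sup>2)"
    by (simp add: fun_eq_iff)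
  ultimately show ?thesis unfolding has_wirtinger_derivs_def has_field_derivative_def by simp
qed

lemma polar_form:
  assumes "1 \<le> cmod z"
  obtains e where "cmod e = 1" and "z = of_real (cmod z) * e"
proof
  have "z \<noteq> 0" using assms by auto
  then show "cmod (sgn z) = 1" by (simp add: norm_sgn)
  show "z = of_real (cmod z) * sgn z"
    using \<open>z \<noteq> 0\<close> by (simp add: sgn_eq)
qed

text \<open>Outside the disc \<open>|\<beta>| / |\<alpha>|\<close> is \<open>|a|\<close> times
  \<open>(1 - 1/n) / |1 - a * e / n|\<close>, and this quotient is at most 1 because
  \<open>|a * e| < 1\<close>. The condition \<open>\<alpha> \<noteq> 0\<close> serves the
  orientation, the uniform upper bound the Lipschitz property.\<close>

lemma disc_ext_wirtinger:
  "\<exists>\<alpha> \<beta>. has_wirtinger_derivs (disc_ext a) \<alpha> \<beta> z \<and> \<alpha> \<noteq> 0 \<and> cmod \<beta> \<le> cmod a * cmod \<alpha> \<and>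
     cmod \<alpha> \<le> 2 / (1 - cmod a) ^ 3"
proof (cases "cmod z < 1")
  case True
  then have z: "z \<in> ball 0 1" by simp
  have "has_wirtinger_derivs (disc_ext a) (1 / (1 - a * z)\<^sup>2) 0 z"
    using has_derivative_transform_within_open[OF disc_wirtinger[of z, unfolded has_wirtinger_derivs_def] open_ball z] True
    unfolding has_wirtinger_derivs_def by (simp add: disc_ext_def)
  moreover have "1 - a * z \<noteq> 0" using one_minus_mult_nz[OF a1, of z] True by simp
  moreover have "cmod (1 / (1 - a * z)\<^sup>2) \<le> 2 / (1 - cmod a) ^ 3"
  proof -
    have "cmod (1 / (1 - a * z)\<^sup>2) = 1 / (cmod (1 - a * z))\<^sup>2" by (simp add: norm_divide norm_power)
    also have "\<dots> \<le> 1 / (1 - cmod a)\<^sup>2"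
      using one_minus_mult_ge[OF a1, of z] True a1 by (intro divide_left_mono power_mono mult_pos_pos) auto
    \<comment> \<open>The larger constant is the one that also holds outside the disc, where the
      numerator of \<open>\<alpha>\<close> is only bounded by 2 and the denominator is a
      cube.\<close>
    also have "\<dots> \<le> 2 / (1 - cmod a) ^ 3"
    proof -
      have "(1 - cmod a) ^ 3 \<le> (1 - cmod a)\<^sup>2" using a1 by (intro power_decreasing) auto
      then show ?thesis using a1 by (intro frac_le) auto
    qed
    finally show ?thesis .
  qed
  ultimately show ?thesis by (intro exI[of _ "1 / (1 - a * z)\<^sup>2"] exI[of _ 0]) auto
next
  case False
  then obtain e where e: "cmod e = 1" "z = of_real (cmod z) * e" using polar_form[of z] by auto
  define n where "n = cmod z"
  have n: "1 \<le> n" using False by (simp add: n_def)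
  have z: "z = of_real n * e" using e by (simp add: n_def)
  define \<alpha> \<beta> where "\<alpha> = (1 - a * e / of_real n) / (1 - a * e) ^ 3"
    and "\<beta> = - (a * e ^ 3 * (1 - 1 / of_real n) / (1 - a * e) ^ 3)"
  have d: "1 - a * e \<noteq> 0" using one_minus_mult_nz[OF a1, of e] e by simp
  have ray: "has_wirtinger_derivs (ray_ext a) \<alpha> \<beta> z"
    unfolding \<alpha>_def \<beta>_def z using ray_ext_wirtinger[OF e(1)] n by simp
  have "has_wirtinger_derivs (disc_ext a) \<alpha> \<beta> z"
  proof (cases "n = 1")
    case True
    then have ze: "z = e" using z by simp
    have "\<alpha> = 1 / (1 - a * z)\<^sup>2" "\<beta> = 0"
      using True d by (simp_all add: \<alpha>_def \<beta>_def ze power2_eq_square power3_eq_cube)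
    then have "has_wirtinger_derivs (\<lambda>w. w / (1 - a * w)) \<alpha> \<beta> z"
      using disc_wirtinger[of z] True by (simp add: n_def)
    moreover have "z / (1 - a * z) = ray_ext a z"
      using ray_ext_polar[OF e(1), of 1] d by (simp add: ze power2_eq_square)
    ultimately show ?thesis
      using ray has_derivative_pointwise_choice[of "\<lambda>w. w / (1 - a * w)" _ z "ray_ext a" "disc_ext a"]
      unfolding has_wirtinger_derivs_def by (simp add: disc_ext_def)
  next
    case False
    have op: "open (- cball (0::complex) 1)" by (simp add: open_Compl)
    have "z \<in> - cball 0 1" using False n by (simp add: n_def)
    from has_derivative_transform_within_open[OF ray[unfolded has_wirtinger_derivs_def] op this]
    show ?thesis unfolding has_wirtinger_derivs_def by (simp add: disc_ext_def)
  qed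
  moreover have "1 - 1 / n \<le> cmod (1 - a * e / of_real n)"
  proof -
    have "cmod (a * e / of_real n) \<le> 1 / n"
      using e a1 n by (simp add: norm_divide norm_mult divide_right_mono)
    then show ?thesis using norm_triangle_ineq2[of 1 "a * e / of_real n"] by simp
  qed
  then have "cmod \<beta> \<le> cmod a * cmod \<alpha>"
  proof -
    assume *: "1 - 1 / n \<le> cmod (1 - a * e / of_real n)"
    have "cmod (1 - 1 / complex_of_real n) = 1 - 1 / n"
    proof -
      have "cmod (1 - 1 / complex_of_real n) = cmod (complex_of_real (1 - 1 / n))" by simp
      also have "\<dots> = \<bar>1 - 1 / n\<bar>" by (rule norm_of_real)
      finally show ?thesis using n by simp
    qed
    then have "cmod \<beta> = cmod a * ((1 - 1 / n) / cmod (1 - a * e) ^ 3)"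
      using e(1) by (simp add: \<beta>_def norm_mult norm_divide norm_power)
    also have "\<dots> \<le> cmod a * (cmod (1 - a * e / of_real n) / cmod (1 - a * e) ^ 3)"
      using * by (intro mult_left_mono divide_right_mono) auto
    also have "\<dots> = cmod a * cmod \<alpha>" by (simp add: \<alpha>_def norm_divide norm_power)
    finally show ?thesis .
  qed
  moreover have en: "cmod (e / of_real n) \<le> 1" using e(1) n by (simp add: norm_divide)
  have "\<alpha> \<noteq> 0" using one_minus_mult_nz[OF a1 en] d by (simp add: \<alpha>_def)
  moreover have "cmod \<alpha> \<le> 2 / (1 - cmod a) ^ 3"
  proof -
    have "cmod (a * (e / of_real n)) \<le> 1 * 1"
      unfolding norm_mult using a1 en by (intro mult_mono) auto
    then have "cmod (1 - a * e / of_real n) \<le> 2"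
      using norm_triangle_ineq4[of 1 "a * e / of_real n"] by simp
    moreover have "(1 - cmod a) ^ 3 \<le> cmod (1 - a * e) ^ 3"
      using one_minus_mult_ge[OF a1, of e] e a1 by (intro power_mono) auto
    ultimately show ?thesis
      unfolding \<alpha>_def norm_divide norm_power using a1 by (intro frac_le) auto
  qed
  ultimately show ?thesis by blast
qed

end

section \<open>Regularity of the radial extension in the plane and at infinity\<close>

context
  fixes a :: complex
  assumes a1: "cmod a < 1"
begin

lemma dilatation_le_at_disc_ext: "dilatation_le_at (cmod a) (disc_ext a) z"
  using disc_ext_wirtinger[OF a1, of z] unfolding dilatation_le_at_def has_wirtinger_derivs_def by blast

lemma nearly_linear_disc_ext: "nearly_linear (disc_ext a) z"
proof -
  obtain \<alpha> \<beta> where *: "has_wirtinger_derivs (disc_ext a) \<alpha> \<beta> z" "\<alpha> \<noteq> 0" "cmod \<beta> \<le> cmod a * cmod \<alpha>"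
    using disc_ext_wirtinger[OF a1, of z] by blast
  have "cmod a * cmod \<alpha> < 1 * cmod \<alpha>" using a1 *(2) by (intro mult_strict_right_mono) auto
  then have "cmod \<beta> < cmod \<alpha>" using *(3) by linarith
  then show ?thesis
    using *(1) by (intro nearly_linear_of_derivative[of _ \<alpha> \<beta>]) (auto simp: has_wirtinger_derivs_def)
qed

lemma lip_at_disc_ext: "lip_at (disc_ext a) z"
proof -
  define M where "M = 2 / (1 - cmod a) ^ 3"
  have "\<exists>D. (disc_ext a has_derivative D) (at w) \<and> (\<forall>h. cmod (D h) \<le> 2 * M * cmod h)" for w
  proof -
    obtain \<alpha> \<beta> where *: "has_wirtinger_derivs (disc_ext a) \<alpha> \<beta> w" "cmod \<beta> \<le> cmod a * cmod \<alpha>" "cmod \<alpha> \<le> M"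
      using disc_ext_wirtinger[OF a1, of w] unfolding M_def by blast
    have "cmod a * cmod \<alpha> \<le> 1 * cmod \<alpha>" using a1 by (intro mult_right_mono) auto
    then have b: "cmod \<beta> \<le> M" using *(2,3) by linarith
    have "cmod (\<alpha> * h + \<beta> * cnj h) \<le> 2 * M * cmod h" for h
    proof -
      have "cmod (\<alpha> * h + \<beta> * cnj h) \<le> cmod \<alpha> * cmod h + cmod \<beta> * cmod h"
        by (metis complex_mod_cnj norm_mult norm_triangle_ineq)
      also have "\<dots> \<le> M * cmod h + M * cmod h"
        using *(3) b by (intro add_mono mult_right_mono) auto
      finally show ?thesis by simp
    qed
    then show ?thesis using *(1) unfolding has_wirtinger_derivs_def by blast
  qed
  then obtain D where "\<And>w. (disc_ext a has_derivative D w) (at w)" "\<And>w h. cmod (D w h) \<le> 2 * M * cmod h"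
    by metis
  then show ?thesis by (intro lip_at_derivative_bound[of 1 z _ D "2 * M"]) auto
qed

text \<open>With \<open>1 / w = e / \<rho>\<close> the reciprocal becomes
  \<open>w * (1 - a * e)^2 / (1 - a * cnj w)\<close>, and \<open>w * e = \<rho>\<close>,
  \<open>\<rho> * e = cnj w\<close> eliminate \<open>e\<close>. The result is visibly Lipschitz near
  0, although \<open>|w|\<close> is not differentiable there.\<close>

lemma disc_ext_reciprocal:
  assumes "w \<noteq> 0" and "cmod w < 1"
  shows "disc_ext a (1 / w) \<noteq> 0"
    and "1 / disc_ext a (1 / w) = (w - 2 * a * of_real (cmod w) + a\<^sup>2 * cnj w) / (1 - a * cnj w)"
proof -
  define \<rho> where "\<rho> = cmod w"
  define e where "e = of_real \<rho> / w"
  have \<rho>: "0 < \<rho>" "\<rho> < 1" using assms by (auto simp: \<rho>_def)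
  have e: "cmod e = 1" using \<rho> assms by (simp add: e_def norm_divide \<rho>_def)
  have e0: "e \<noteq> 0" using e by auto
  have w: "w = of_real \<rho> / e" using \<rho> assms by (simp add: e_def)
  have z: "1 / w = of_real (1 / \<rho>) * e" using \<rho> assms by (simp add: e_def)
  have ww: "w * cnj w = of_real \<rho> * of_real \<rho>"
    using complex_norm_square[of w] by (simp add: \<rho>_def power2_eq_square)
  have cw: "cnj w = of_real \<rho> * e"
    using ww assms by (simp add: e_def field_simps)
  have d: "1 - a * e \<noteq> 0" using one_minus_mult_nz[OF a1, of e] e by simp
  have d2: "1 - a * (of_real \<rho> * e) \<noteq> 0"
    using one_minus_mult_nz[OF a1, of "of_real \<rho> * e"] e \<rho> by (simp add: norm_mult)
  have "\<not> cmod (1 / w) < 1" using \<rho> by (simp add: norm_divide \<rho>_def)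
  then have "disc_ext a (1 / w) = ray_ext a (of_real (1 / \<rho>) * e)"
    by (simp add: disc_ext_def z)
  also have "\<dots> = e * (of_real (1 / \<rho>) - a * e) / (1 - a * e)\<^sup>2"
    using \<rho> by (intro ray_ext_polar[OF a1 e]) auto
  also have "of_real (1 / \<rho>) - a * e = (1 - a * (of_real \<rho> * e)) / of_real \<rho>"
    using \<rho> by (simp add: field_simps)
  finally have H: "disc_ext a (1 / w) = e * ((1 - a * (of_real \<rho> * e)) / of_real \<rho>) / (1 - a * e)\<^sup>2" .
  show "disc_ext a (1 / w) \<noteq> 0"
    unfolding H using e0 d d2 \<rho> by (simp del: diff_eq_eq)
  have "1 / disc_ext a (1 / w) = (of_real \<rho> / e) * (1 - a * e)\<^sup>2 / (1 - a * (of_real \<rho> * e))"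
    unfolding H by simp
  also have "(of_real \<rho> / e) * (1 - a * e)\<^sup>2 = w - 2 * a * of_real \<rho> + a\<^sup>2 * (of_real \<rho> * e)"
    unfolding w using e0 by (simp add: power2_eq_square field_simps)
  finally show "1 / disc_ext a (1 / w) = (w - 2 * a * of_real (cmod w) + a\<^sup>2 * cnj w) / (1 - a * cnj w)"
    by (simp add: cw flip: \<rho>_def)
qed

lemma lip_at_disc_ext_infinity: "lip_at (\<lambda>w. if w = 0 then 0 else 1 / disc_ext a (1 / w)) 0"
proof -
  have "lip_at (\<lambda>w. w - 2 * a * of_real (cmod w) + a\<^sup>2 * cnj w) 0"
  proof (rule lipschitz_on_UNIV_imp_lip_at)
    show "(1 + 2 * cmod a + (cmod a)\<^sup>2)-lipschitz_on UNIV (\<lambda>w. w - 2 * a * of_real (cmod w) + a\<^sup>2 * cnj w)"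
    proof (rule lipschitz_onI)
      fix v w
      have "(v - 2 * a * of_real (cmod v) + a\<^sup>2 * cnj v) - (w - 2 * a * of_real (cmod w) + a\<^sup>2 * cnj w)
          = (v - w) - 2 * a * of_real (cmod v - cmod w) + a\<^sup>2 * cnj (v - w)"
        by (simp add: algebra_simps)
      also have "cmod \<dots> \<le> cmod (v - w) + cmod (2 * a * of_real (cmod v - cmod w)) + cmod (a\<^sup>2 * cnj (v - w))"
        by (meson add_right_mono norm_triangle_ineq norm_triangle_ineq4 order_trans)
      also have "\<dots> = cmod (v - w) + 2 * cmod a * \<bar>cmod v - cmod w\<bar> + (cmod a)\<^sup>2 * cmod (v - w)"
        by (simp only: norm_mult norm_power complex_mod_cnj norm_of_real) simp
      also have "\<dots> \<le> cmod (v - w) + 2 * cmod a * cmod (v - w) + (cmod a)\<^sup>2 * cmod (v - w)"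
        by (intro add_mono mult_left_mono norm_triangle_ineq3) auto
      finally show "dist (v - 2 * a * of_real (cmod v) + a\<^sup>2 * cnj v) (w - 2 * a * of_real (cmod w) + a\<^sup>2 * cnj w)
          \<le> (1 + 2 * cmod a + (cmod a)\<^sup>2) * dist v w"
        by (simp add: dist_norm algebra_simps)
    qed simp
  qed
  moreover have "lip_at (\<lambda>w. 1 / (1 - a * cnj w)) 0"
  proof (rule lip_at_compose[where g = "\<lambda>v. 1 / (1 - a * v)"])
    show "lip_at cnj 0"
      by (rule lipschitz_on_UNIV_imp_lip_at[of 1]) (auto simp: lipschitz_on_def dist_norm simp flip: complex_cnj_diff)
    have "(\<lambda>v. 1 / (1 - a * v)) holomorphic_on ball 0 1"
      using one_minus_mult_nz[OF a1] by (intro holomorphic_intros) (auto simp: less_imp_le)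
    then show "lip_at (\<lambda>v. 1 / (1 - a * v)) (cnj 0)"
      by (rule lip_at_holomorphic) auto
  qed
  ultimately have "lip_at (\<lambda>w. (w - 2 * a * of_real (cmod w) + a\<^sup>2 * cnj w) * (1 / (1 - a * cnj w))) 0"
    by (rule lip_at_mult)
  moreover have "\<forall>\<^sub>F w in nhds 0. w \<in> ball (0::complex) 1"
    by (intro eventually_nhds_in_open) auto
  then have "\<forall>\<^sub>F w in nhds 0. (if w = 0 then 0 else 1 / disc_ext a (1 / w)) =
      (w - 2 * a * of_real (cmod w) + a\<^sup>2 * cnj w) * (1 / (1 - a * cnj w))"
    by eventually_elim (use disc_ext_reciprocal in auto)
  ultimately show ?thesis by (rule lip_at_cong[rotated])
qed

text \<open>Up to the affine map \<open>v \<mapsto> (cnj a + v) / (1 - \<bar>a\<bar>\<^sup>2)\<close>, which normalises the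
  image disc, \<^const>\<open>disc_ext\<close> is a disc automorphism, continued along the radii.\<close>

definition radius :: real where "radius = 1 / (1 - (cmod a)\<^sup>2)"

lemma radius_pos: "radius > 0"
  using a1 by (simp add: radius_def abs_square_less_1)

lemma radius_eq: "of_real radius * (1 - a * cnj a) = 1"
proof -
  have "1 - a * cnj a = of_real (1 - (cmod a)\<^sup>2)"
    unfolding of_real_diff complex_norm_square by simp
  moreover have "radius * (1 - (cmod a)\<^sup>2) = 1" using radius_pos by (auto simp: radius_def)
  ultimately show ?thesis by (metis of_real_1 of_real_mult)
qed

lemma disc_ext_inner:
  assumes "cmod z < 1"
  shows "disc_ext a z = of_real radius * (cnj a + mobius a z)"
proof -
  have d: "1 - a * z \<noteq> 0" using one_minus_mult_nz[OF a1, of z] assms by simp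
  have "cnj a + mobius a z = (cnj a * (1 - a * z) + (z - cnj a)) / (1 - a * z)"
    unfolding mobius_def add_divide_distrib using d by simp
  also have "\<dots> = (1 - a * cnj a) * z / (1 - a * z)" by (simp add: algebra_simps)
  finally have "of_real radius * (cnj a + mobius a z) = (of_real radius * (1 - a * cnj a)) * z / (1 - a * z)"
    by (simp only: mult.assoc times_divide_eq_right)
  then show ?thesis using assms by (simp only: radius_eq disc_ext_def if_True) simp
qed

text \<open>For \<open>d = 1 - a * e\<close> one has \<open>mobius a e = e * cnj d / d\<close>, so
  the direction \<open>e / d^2\<close> of the image ray is \<open>mobius a e / |d|^2\<close>. The
  image ray therefore prolongs the radius of the image disc that ends at
  \<open>e / d\<close>.\<close>

lemma disc_ext_outer:
  assumes "cmod e = 1" and "1 \<le> n"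
  shows "disc_ext a (of_real n * e) =
    of_real radius * cnj a + of_real (radius + (n - 1) / (cmod (1 - a * e))\<^sup>2) * mobius a e"
proof -
  define d where "d = 1 - a * e"
  have d: "d \<noteq> 0" using one_minus_mult_nz[OF a1, of e] assms by (simp add: d_def)
  have e0: "e \<noteq> 0" using assms by auto
  have ee: "e * cnj e = 1" using assms complex_norm_square[of e] by simp
  have "e * cnj d = e - cnj a * (e * cnj e)" by (simp add: d_def algebra_simps)
  then have m: "mobius a e = e * cnj d / d" by (simp add: ee mobius_def d_def)
  have dd: "complex_of_real ((cmod d)\<^sup>2) = d * cnj d" using complex_norm_square[of d] by simp
  have "cnj a + mobius a e = (cnj a * d + (e - cnj a)) / d"
    unfolding mobius_def d_def[symmetric] add_divide_distrib using d by simp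
  also have "\<dots> = (1 - a * cnj a) * e / d" by (simp add: d_def algebra_simps)
  finally have "of_real radius * (cnj a + mobius a e) = (of_real radius * (1 - a * cnj a)) * e / d"
    by (simp only: mult.assoc times_divide_eq_right)
  then have 1: "of_real radius * cnj a + of_real radius * mobius a e = e / d"
    by (simp only: radius_eq distrib_left) simp
  have 2: "of_real ((n - 1) / (cmod d)\<^sup>2) * mobius a e = (of_real n - 1) * e / d\<^sup>2"
    unfolding of_real_divide dd m using d by (simp add: power2_eq_square)
  have "\<not> cmod (of_real n * e) < 1" using assms by (simp add: norm_mult)
  then have "disc_ext a (of_real n * e) = ray_ext a (of_real n * e)" by (simp add: disc_ext_def)
  also have "\<dots> = e * (of_real n - a * e) / d\<^sup>2"
    using ray_ext_polar[OF a1 assms(1), of n] assms(2) by (simp add: d_def)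
  also have "of_real n - a * e = (of_real n - 1) + d" by (simp add: d_def)
  also have "e * ((of_real n - 1) + d) / d\<^sup>2 = e / d + (of_real n - 1) * e / d\<^sup>2"
    using d by (simp add: field_simps power2_eq_square)
  finally show ?thesis
    unfolding of_real_add distrib_right d_def[symmetric] using 1 2 by (simp add: add.assoc[symmetric])
qed

lemma disc_ext_outer_factor:
  assumes "1 \<le> n"
  shows "radius \<le> radius + (n - 1) / (cmod (1 - a * e))\<^sup>2"
  using assms by simp

text \<open>The distance from the centre \<open>radius * cnj a\<close> separates inner points from
  outer ones. For outer points the direction from the centre determines \<open>e\<close>, and the
  distance then determines \<open>n\<close>.\<close>

lemma inj_disc_ext: "inj (disc_ext a)"
proof (rule injI)
  have inner: "cmod (disc_ext a z - of_real radius * cnj a) < radius" if "cmod z < 1" for z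
  proof -
    have "disc_ext a z - of_real radius * cnj a = of_real radius * mobius a z"
      using disc_ext_inner[OF that] by (simp add: algebra_simps)
    then have "cmod (disc_ext a z - of_real radius * cnj a) = radius * cmod (mobius a z)"
      using radius_pos by (simp add: norm_mult)
    also have "\<dots> < radius * 1"
      using mobius_lt_1[OF a1 that] radius_pos by (intro mult_strict_left_mono)
    finally show ?thesis by simp
  qed
  have outer: "\<exists>e n. cmod e = 1 \<and> 1 \<le> n \<and> z = of_real n * e" if "\<not> cmod z < 1" for z
    using polar_form[OF a1, of z] that by (metis not_less)
  have outer': "cmod (disc_ext a (of_real n * e) - of_real radius * cnj a) = radius + (n - 1) / (cmod (1 - a * e))\<^sup>2"
    if "cmod e = 1" "1 \<le> n" for e n
  proof -
    have "0 \<le> radius + (n - 1) / (cmod (1 - a * e))\<^sup>2"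
      using disc_ext_outer_factor[OF that(2), of e] radius_pos by linarith
    then show ?thesis
      using mobius_eq_1[OF a1 that(1)] by (simp only: disc_ext_outer[OF that] add_diff_cancel_left' norm_mult norm_of_real) simp
  qed
  have mixed: False if zw: "cmod z < 1" "\<not> cmod w < 1" "disc_ext a z = disc_ext a w" for z w
  proof -
    obtain e n where w: "cmod e = 1" "1 \<le> n" "w = of_real n * e" using outer[OF zw(2)] by blast
    show False
      using inner[OF zw(1)] outer'[OF w(1,2)] disc_ext_outer_factor[OF w(2), of e] zw(3)
      by (simp add: w(3))
  qed
  fix z w assume eq: "disc_ext a z = disc_ext a w"
  consider "cmod z < 1" "cmod w < 1" | "\<not> cmod z < 1" "\<not> cmod w < 1"
    using mixed[of z w] mixed[of w z] eq by metis
  then show "z = w"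
  proof cases
    case 1
    then have "mobius a z = mobius a w"
      using eq radius_pos by (simp add: disc_ext_inner)
    then show ?thesis using 1 mobius_inj[OF a1, of z w] by simp
  next
    case 2
    obtain e n where z: "cmod e = 1" "1 \<le> n" "z = of_real n * e" using outer[OF 2(1)] by blast
    obtain e' n' where w: "cmod e' = 1" "1 \<le> n'" "w = of_real n' * e'" using outer[OF 2(2)] by blast
    let ?r = "radius + (n - 1) / (cmod (1 - a * e))\<^sup>2"
    have r: "?r = radius + (n' - 1) / (cmod (1 - a * e'))\<^sup>2"
      using outer'[OF z(1,2)] outer'[OF w(1,2)] eq by (simp only: z(3) w(3))
    have "?r > 0" using disc_ext_outer_factor[OF z(2), of e] radius_pos by linarith
    moreover have "of_real ?r * mobius a e = of_real ?r * mobius a e'"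
      using eq unfolding z(3) w(3) disc_ext_outer[OF z(1,2)] disc_ext_outer[OF w(1,2)] r[symmetric]
      by (rule add_left_imp_eq)
    ultimately have "mobius a e = mobius a e'" by (metis less_irrefl mult_left_cancel of_real_eq_0_iff)
    then have e: "e = e'" using mobius_inj[OF a1] z(1) w(1) by simp
    have "1 - a * e' \<noteq> 0" using one_minus_mult_nz[OF a1, of e'] w(1) by simp
    then have "n = n'" using r unfolding e by simp
    then show ?thesis using z w e by simp
  qed
qed

lemma surj_disc_ext: "surj (disc_ext a)"
  unfolding surj_def
proof
  fix y
  define v where "v = y - of_real radius * cnj a"
  have a1': "cmod (- a) < 1" using a1 by simp
  show "\<exists>z. y = disc_ext a z"
  proof (cases "cmod v < radius")
    case True
    have v1: "cmod (v / of_real radius) < 1" using True radius_pos by (simp add: norm_divide)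
    define z where "z = mobius (- a) (v / of_real radius)"
    have z: "cmod z < 1" unfolding z_def by (rule mobius_lt_1[OF a1' v1])
    have "mobius a z = v / of_real radius"
      unfolding z_def using v1 by (intro mobius_mobius[OF a1]) simp
    then have "disc_ext a z = of_real radius * cnj a + v"
      using disc_ext_inner[OF z] radius_pos by (simp add: distrib_left)
    then show ?thesis by (intro exI[of _ z]) (simp add: v_def)
  next
    case False
    define \<rho> where "\<rho> = cmod v"
    have \<rho>: "\<rho> \<ge> radius" "\<rho> > 0" using False radius_pos by (auto simp: \<rho>_def)
    have u: "cmod (v / of_real \<rho>) = 1" using \<rho> by (simp add: norm_divide \<rho>_def)
    define e where "e = mobius (- a) (v / of_real \<rho>)"
    have e: "cmod e = 1" unfolding e_def by (rule mobius_eq_1[OF a1' u])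
    have me: "mobius a e = v / of_real \<rho>"
      unfolding e_def using u by (intro mobius_mobius[OF a1]) simp
    have d: "cmod (1 - a * e) \<noteq> 0" using one_minus_mult_nz[OF a1, of e] e by simp
    \<comment> \<open>The solution of \<open>radius + (n - 1) / |1 - a * e|^2 = \<rho>\<close>; it
      is at least 1 since \<open>\<rho> \<ge> radius\<close>.\<close>
    define n where "n = 1 + (\<rho> - radius) * (cmod (1 - a * e))\<^sup>2"
    have n: "1 \<le> n" using \<rho> by (simp add: n_def)
    have "radius + (n - 1) / (cmod (1 - a * e))\<^sup>2 = \<rho>" using d by (simp add: n_def)
    then have "disc_ext a (of_real n * e) = of_real radius * cnj a + v"
      using disc_ext_outer[OF e n] me \<rho> by simp
    then show ?thesis by (intro exI[of _ "of_real n * e"]) (simp add: v_def)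
  qed
qed

lemma quasiconformal_disc_ext: "quasiconformal (cmod a) (fix_infinity (disc_ext a))"
proof -
  have "continuous_on UNIV (disc_ext a)" by (rule lip_at_continuous_on) (rule lip_at_disc_ext)
  then obtain K where "homeomorphism UNIV (range (disc_ext a)) (disc_ext a) K"
    using invariance_of_domain_homeomorphism[OF open_UNIV _ order_refl inj_disc_ext] by blast
  then have K: "homeomorphism UNIV UNIV (disc_ext a) K" using surj_disc_ext by simp
  have rep: "chart_rep id id (fix_infinity (disc_ext a)) = disc_ext a"
    by (auto simp: chart_rep_def fun_eq_iff)
  have "\<forall>\<^sub>F w in nhds 0. w \<in> ball (0::complex) 1"
    by (intro eventually_nhds_in_open) auto
  then have H0: "\<forall>\<^sub>F w in at 0. disc_ext a (1 / w) \<noteq> 0"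
    unfolding eventually_at_filter by eventually_elim (use disc_ext_reciprocal(1) in auto)
  have "sense_preserving (fix_infinity (disc_ext a))"
    by (rule sense_preservingI) (simp_all only: rep lip_at_disc_ext nearly_linear_disc_ext)
  moreover have "charts_dilatation (cmod a) (fix_infinity (disc_ext a))"
    by (intro charts_dilatation_fix_infinity norm_ge_zero lip_at_disc_ext lip_at_disc_ext_infinity dilatation_le_at_disc_ext H0)
  ultimately show ?thesis
    using a1 homeomorphic_map_fix_infinity[OF K]
    by (simp add: quasiconformal_def charts_dilatation_def)
qed

end

section \<open>The case of identically vanishing \<open>U_f\<close>\<close>

lemma class_U_extension_of_U_op_eq_0:
  assumes lam: "0 < lam" "lam < 1" and f: "f \<in> class_U lam"
    and a: "\<And>z. z \<in> ball 0 1 \<Longrightarrow> (\<lambda>n. a (n + 2) * z ^ (n + 2)) sums (f z - z)"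
    and U0: "\<And>z. z \<in> ball 0 1 \<Longrightarrow> U_op f z = 0" and a2: "cmod (a 2) < 1"
  shows "\<exists>F. (\<forall>z. F (Some z) =
            (if cmod z < 1 then sphere_div z (1 - a 2 * z)
             else sphere_div (z * (of_real ((cmod z)\<^sup>2) - a 2 * z))
                    ((of_real (cmod z) - a 2 * z)\<^sup>2))) \<and>
          qc_extension (cmod (a 2)) (ball 0 1) f F"
proof -
  obtain p where hp: "p holomorphic_on ball 0 1" and p0: "p 0 = 0"
    and q: "\<And>z. z \<in> ball 0 1 \<Longrightarrow> recip_quot f z = 1 - a 2 * z + z * p z"
    and fq: "\<And>z. z \<in> ball 0 1 \<Longrightarrow> f z = z / recip_quot f z"
    and U: "\<And>z. z \<in> ball 0 1 \<Longrightarrow> U_op f z = - (z\<^sup>2 * deriv p z)"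
    using class_U_recip_quot[OF less_imp_le[OF lam(2)] f a] by metis
  \<comment> \<open>The derivative bound with 0 in place of \<open>lam\<close> makes
    \<open>p\<close> constant, hence 0 because of \<open>p 0 = 0\<close>, and \<open>f\<close> is
    the Moebius map.\<close>
  have "cmod (z\<^sup>2 * deriv p z) \<le> 0" if "z \<in> ball 0 1" for z
    using U[OF that] U0[OF that] by simp
  then have "0-lipschitz_on (ball 0 1) p"
    using deriv_bound_of_square_multiple[OF hp, of 0] hp
    by (intro lipschitz_on_ball_of_deriv_bound) auto
  then have "p z = 0" if "z \<in> ball 0 1" for z
    using lipschitz_onD[of 0 "ball 0 1" p z 0] that p0 by simp
  then have fz: "f z = z / (1 - a 2 * z)" if "z \<in> ball 0 1" for z
    using fq[OF that] q[OF that] that by simp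
  let ?F = "fix_infinity (disc_ext (a 2))"
  \<comment> \<open>As \<open>|a 2| < 1\<close>, the denominator has no zero outside the disc, so
    the formula has finite values at finite points, as \<open>fix_infinity\<close> demands.\<close>
  have nz: "of_real (cmod z) - a 2 * z \<noteq> 0" if "\<not> cmod z < 1" for z
  proof
    assume "of_real (cmod z) - a 2 * z = 0"
    then have "cmod (of_real (cmod z)) = cmod (a 2 * z)" by simp
    then have "1 * cmod z = cmod (a 2) * cmod z" by (simp add: norm_mult)
    then have "cmod z = 0 \<or> 1 = cmod (a 2)" by (simp only: mult_cancel_right)
    with that a2 show False by auto
  qed
  have formula: "?F (Some z) =
            (if cmod z < 1 then sphere_div z (1 - a 2 * z)
             else sphere_div (z * (of_real ((cmod z)\<^sup>2) - a 2 * z))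
                    ((of_real (cmod z) - a 2 * z)\<^sup>2))" for z
  proof (cases "cmod z < 1")
    case True
    then have "1 - a 2 * z \<noteq> 0" using one_minus_mult_nz[OF a2, of z] by simp
    then show ?thesis using True by (simp add: disc_ext_def sphere_div_def del: right_minus_eq)
  next
    case False
    then show ?thesis using nz[OF False] by (simp add: disc_ext_def ray_ext_def sphere_div_def del: right_minus_eq)
  qed
  have "f holomorphic_on ball 0 1" using f by (simp add: class_U_def class_A_def)
  then have "qc_extension (cmod (a 2)) (ball 0 1) f ?F"
    by (intro qc_extensionI quasiconformal_disc_ext[OF a2]) (auto simp: fz disc_ext_def)
  with formula show ?thesis by blast
qed

theorem theorem1:
  fixes lam :: real and f :: "complex \<Rightarrow> complex" and a :: "nat \<Rightarrow> complex"
  assumes "0 < lam" and "lam < 1"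
    and "f \<in> class_U lam"
    and "\<And>z. z \<in> ball 0 1 \<Longrightarrow> (\<lambda>n. a (n + 2) * z ^ (n + 2)) sums (f z - z)"
  shows
    "(\<not> (\<forall>z\<in>ball 0 1. U_op f z = 0) \<longrightarrow>
       phi f (a 2) 0 = 0 \<and>
       (phi f (a 2) has_field_derivative 0) (at 0) \<and>
       (\<forall>z\<in>ball 0 1. f z = z / (1 - a 2 * z + phi f (a 2) z)) \<and>
       (\<exists>\<Phi> F. continuous_on (cball 0 1) \<Phi> \<and>
          (\<forall>z\<in>ball 0 1. \<Phi> z = phi f (a 2) z) \<and>
          (\<forall>z. F (Some z) =
            (if cmod z < 1 then sphere_div z (1 - a 2 * z + \<Phi> z)
             else sphere_div z (1 - a 2 * z + of_real ((cmod z)\<^sup>2) * \<Phi> (1 / cnj z)))) \<and>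
          qc_extension lam (ball 0 1) f F)) \<and>
     ((\<forall>z\<in>ball 0 1. U_op f z = 0) \<and> a 2 \<in> ball 0 1 - {0} \<longrightarrow>
       (\<exists>F. (\<forall>z. F (Some z) =
            (if cmod z < 1 then sphere_div z (1 - a 2 * z)
             else sphere_div (z * (of_real ((cmod z)\<^sup>2) - a 2 * z))
                    ((of_real (cmod z) - a 2 * z)\<^sup>2))) \<and>
          qc_extension (cmod (a 2)) (ball 0 1) f F))"
  using class_U_extension[OF assms] class_U_extension_of_U_op_eq_0[OF assms]
  by (intro conjI impI ballI) (simp_all only: mem_ball_0 Diff_iff)

end
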